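(* Every IMCGD can be extended into a vertex-preserving, invisible matter quiescent CGD over $\overline{\mathcal{Y}}$.
   Context: Fix finite sets $\pi$ (ports), $\Sigma,\Delta$ (labels), with $m\notin\Sigma$, $m,l,r\notin\pi$. A graph has an at most countable vertex set, edges $\{u:a,v:b\}$ (unordered, $a,b$ ports) with each vertex–port pair in at most one edge, partial vertex and edge labels, and is connected. Pointed graphs modulo are isomorphism classes of pointed graphs under renamings preserving edges, ports, labels and pointer. In a pointed graph modulo $X$, vertices are designated by paths (words of port pairs $ab$, "leave by $a$, arrive by $b$", from the pointer), identified when reaching the same vertex; $V(X)$ is the vertex set, "." concatenation, $X_u$ the re-pointing at $u$, $X^r$ the disk of radius $r$ (subgraph induced by vertices at distance $\le r+1$ from the pointer, labels kept only on vertices at distance $\le r$ and edges between them). A dynamics $(F,R_\bullet)$ over a set $\mathcal{S}$ of pointed graphs modulo is $F:\mathcal{S}\to\mathcal{S}$ with maps $R_X:V(X)\to V(F(X))$; continuous: for all $X,m$ there is $n$ with $F(X)^m=F(X^n)^m$, $\mathrm{dom}\,R_X^m\subseteq V(X^n)$, $R_X^m=R_{X^n}^m$ ($R_X^m$ = restriction of $R_X$ to vertices mapped into $F(X)^m$); shift-invariant: $F(X_u)=F(X)_{R_X(u)}$, $R_X(u.v)=R_X(u).R_{X_u}(v)$; bounded: there is $b$ such that every $w'\in V(F(X))$ is $u'.v'$ with $u'\in\mathrm{Im}R_X$, $v'\in V(F(X)^b_{u'})$. A CGD over $\mathcal{S}$ is a continuous, shift-invariant, bounded dynamics over $\mathcal{S}$.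 Let $\mathcal{X}'=\mathcal{X}_{\Sigma\cup\{m\},\Delta,\pi\cup\{m,l,r\}}$; $T$ is the infinite rooted binary tree, all vertices labelled $m$, each vertex linked via port $l$ (resp. $r$) to port $m$ of its left (resp. right) child. Each $X\in\mathcal{X}_{\Sigma,\Delta,\pi}$ is identified with the graph of $\mathcal{X}'$ obtained by attaching to each vertex $v$ a copy of $T$ whose root's port $m$ is linked to port $m$ of $v$; $\mathcal{Y}$ is the set of all such graphs pointed at any vertex. $X_{\bullet s}=X_{mm.s}$, $s\in\{lm,rm\}^*$. A dynamics over a set $\mathcal{S}\supseteq\mathcal{Y}$ is invisible matter quiescent if there is $b$ with $R_{X_{\bullet s}}(t)=t$ for all $X\in\mathcal{X}_{\Sigma,\Delta,\pi}$ and $s,t\in\{lm,rm\}^*$ with $|s|\ge b$; vertex-preserving if every $R_Y$ is bijective. An IMCGD is a vertex-preserving invisible matter quiescent CGD over $\mathcal{Y}$. $\overline{\mathcal{Y}}$ is the set of $Y'\in\mathcal{X}'$ such that for every $r$ there is $Y\in\mathcal{Y}$ with $Y^r=Y'^r$. An extension of $(F,R_\bullet)$ over $\mathcal{Y}$ to $\overline{\mathcal{Y}}$ is a dynamics over $\overline{\mathcal{Y}}$ agreeing with $(F,R_\bullet)$ on $\mathcal{Y}$.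
   Formalization: Continuity is stated by comparing X with every X' in the set having the same disk X'^n = X^n, instead of using F(X^n) and R_{X^n}, which are undefined because disks of graphs in Y or its closure are finite and lie outside the domain of the dynamics. *)

theory Defs
  imports "HOL-Library.Countable_Set"
begin

section \<open>Pointed graphs\<close>

text \<open>
  An edge \<open>{u:a, v:b}\<close> is a two-element set of vertex-port pairs, labels are partial functions.
\<close>

record ('v, 's, 'd, 'p) pgraph =
  verts :: "'v set"
  edges :: "('v \<times> 'p) set set"
  vlab :: "'v \<Rightarrow> 's option"
  elab :: "('v \<times> 'p) set \<Rightarrow> 'd option"
  ptr :: 'v

text \<open>A letter \<open>(a, b)\<close> of a path means: leave by port \<open>a\<close>, arrive by port \<open>b\<close>.\<close>

type_synonym 'p path = "('p \<times> 'p) list"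

primrec walk :: "('v, 's, 'd, 'p) pgraph \<Rightarrow> 'p path \<Rightarrow> 'v \<Rightarrow> 'v \<Rightarrow> bool" where
  "walk G [] u v \<longleftrightarrow> u \<in> verts G \<and> u = v"
| "walk G (c # w) u v \<longleftrightarrow> (\<exists>x. {(u, fst c), (x, snd c)} \<in> edges G \<and> walk G w x v)"

definition pointed_graph :: "('v, 's, 'd, 'p) pgraph \<Rightarrow> bool" where
  "pointed_graph G \<longleftrightarrow>
     countable (verts G) \<and>
     (\<forall>e\<in>edges G. card e = 2 \<and> fst ` e \<subseteq> verts G) \<and>
     (\<forall>e\<in>edges G. \<forall>e'\<in>edges G. e \<inter> e' \<noteq> {} \<longrightarrow> e = e') \<and>
     dom (vlab G) \<subseteq> verts G \<and>
     dom (elab G) \<subseteq> edges G \<and>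
     (\<forall>u\<in>verts G. \<forall>v\<in>verts G. \<exists>w. walk G w u v) \<and>
     ptr G \<in> verts G"

definition over_alphabets ::
    "'s set \<Rightarrow> 'd set \<Rightarrow> 'p set \<Rightarrow> ('v, 's, 'd, 'p) pgraph \<Rightarrow> bool" where
  "over_alphabets \<Sigma> \<Delta> \<pi> G \<longleftrightarrow>
     ran (vlab G) \<subseteq> \<Sigma> \<and> ran (elab G) \<subseteq> \<Delta> \<and> (\<forall>e\<in>edges G. snd ` e \<subseteq> \<pi>)"

definition pgraph_iso ::
    "('v \<Rightarrow> 'w) \<Rightarrow> ('v, 's, 'd, 'p) pgraph \<Rightarrow> ('w, 's, 'd, 'p) pgraph \<Rightarrow> bool" where
  "pgraph_iso f G H \<longleftrightarrow>
     bij_betw f (verts G) (verts H) \<and>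
     edges H = (\<lambda>e. map_prod f id ` e) ` edges G \<and>
     (\<forall>v\<in>verts G. vlab H (f v) = vlab G v) \<and>
     (\<forall>e\<in>edges G. elab H (map_prod f id ` e) = elab G e) \<and>
     ptr H = f (ptr G)"

definition ball_verts :: "('v, 's, 'd, 'p) pgraph \<Rightarrow> nat \<Rightarrow> 'v set" where
  "ball_verts G k = {v. \<exists>w. length w \<le> k \<and> walk G w (ptr G) v}"

definition disk_graph :: "nat \<Rightarrow> ('v, 's, 'd, 'p) pgraph \<Rightarrow> ('v, 's, 'd, 'p) pgraph" where
  "disk_graph r G = \<lparr>
     verts = ball_verts G (r + 1),
     edges = {e \<in> edges G. fst ` e \<subseteq> ball_verts G (r + 1)},
     vlab = vlab G |` ball_verts G r,
     elab = elab G |` {e. fst ` e \<subseteq> ball_verts G r},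
     ptr = ptr G\<rparr>"


section \<open>Pointed graphs modulo\<close>

text \<open>
  A pointed graph modulo is an isomorphism class. Since vertex sets are at most countable, it is
  enough to collect the representatives whose vertices are natural numbers; the vertex type of the
  graph \<open>G\<close> generating the class is arbitrary.
\<close>

type_synonym ('s, 'd, 'p) pgm = "(nat, 's, 'd, 'p) pgraph set"

definition iso_class :: "('v, 's, 'd, 'p) pgraph \<Rightarrow> ('s, 'd, 'p) pgm" where
  "iso_class G = {H. pointed_graph H \<and> (\<exists>f. pgraph_iso f G H)}"

definition pgms :: "'s set \<Rightarrow> 'd set \<Rightarrow> 'p set \<Rightarrow> ('s, 'd, 'p) pgm set" where
  "pgms \<Sigma> \<Delta> \<pi> =
     {iso_class G | G :: (nat, 's, 'd, 'p) pgraph. pointed_graph G \<and> over_alphabets \<Sigma> \<Delta> \<pi> G}"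

definition paths :: "('s, 'd, 'p) pgm \<Rightarrow> 'p path set" where
  "paths X = {w. \<exists>G\<in>X. \<exists>v. walk G w (ptr G) v}"

text \<open>
  A vertex of \<open>X\<close> is the set of all paths that lead to it from the pointer; \<open>vtx X w\<close> is the vertex
  designated by the path \<open>w\<close>, and is empty if \<open>w\<close> is not a path of \<open>X\<close>.
\<close>

type_synonym 'p vertex = "'p path set"

definition vtx :: "('s, 'd, 'p) pgm \<Rightarrow> 'p path \<Rightarrow> 'p vertex" where
  "vtx X w = {w'. \<exists>G\<in>X. \<exists>v. walk G w (ptr G) v \<and> walk G w' (ptr G) v}"

definition V :: "('s, 'd, 'p) pgm \<Rightarrow> 'p vertex set" where
  "V X = vtx X ` paths X"

definition shift :: "('s, 'd, 'p) pgm \<Rightarrow> 'p vertex \<Rightarrow> ('s, 'd, 'p) pgm" where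
  "shift X u = (\<Union>G\<in>X. \<Union>v\<in>{v. \<exists>w\<in>u. walk G w (ptr G) v}. iso_class (G\<lparr>ptr := v\<rparr>))"

definition disk :: "nat \<Rightarrow> ('s, 'd, 'p) pgm \<Rightarrow> ('s, 'd, 'p) pgm" where
  "disk r X = (\<Union>G\<in>X. iso_class (disk_graph r G))"

text \<open>
  \<open>conc X u v\<close> is the vertex \<open>u.v\<close> of \<open>X\<close>. Here \<open>v\<close> is a vertex of \<open>shift X u\<close> or of one of its disks:
  the concatenations \<open>w @ w'\<close> all lead to the same vertex of \<open>X\<close>, but need not exhaust the paths to it.
\<close>

definition conc :: "('s, 'd, 'p) pgm \<Rightarrow> 'p vertex \<Rightarrow> 'p vertex \<Rightarrow> 'p vertex" where
  "conc X u v = (\<Union>w\<in>u. \<Union>w'\<in>v. vtx X (w @ w'))"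


section \<open>Causal graph dynamics over a set of pointed graphs modulo\<close>

type_synonym ('s, 'd, 'p) gmap = "('s, 'd, 'p) pgm \<Rightarrow> ('s, 'd, 'p) pgm"
type_synonym ('s, 'd, 'p) vmap = "('s, 'd, 'p) pgm \<Rightarrow> 'p vertex \<Rightarrow> 'p vertex"

definition dynamics ::
    "('s, 'd, 'p) pgm set \<Rightarrow> ('s, 'd, 'p) gmap \<Rightarrow> ('s, 'd, 'p) vmap \<Rightarrow> bool" where
  "dynamics S F R \<longleftrightarrow> (\<forall>X\<in>S. F X \<in> S \<and> (\<forall>v\<in>V X. R X v \<in> V (F X)))"

text \<open>
  A vertex \<open>v\<close> of \<open>X\<close> lies in \<open>disk n X\<close> iff some path to it stays inside that disk, i.e. iff
  \<open>v \<inter> paths (disk n X)\<close> is nonempty, and this intersection is then the corresponding vertex of the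
  pointed graph modulo \<open>disk n X\<close>.
\<close>

definition in_disk :: "nat \<Rightarrow> ('s, 'd, 'p) pgm \<Rightarrow> 'p vertex \<Rightarrow> bool" where
  "in_disk n X v \<longleftrightarrow> v \<inter> paths (disk n X) \<noteq> {}"

text \<open>
  The domain of \<open>R\<^sub>X\<^sup>m\<close>, and the graph of \<open>R\<^sub>X\<^sup>m\<close> read as a partial function from the vertices of
  \<open>disk n X\<close> to the vertices of \<open>disk m (F X)\<close>; the latter is meaningful when the domain is contained
  in \<open>disk n X\<close>.
\<close>

definition dom_R ::
    "('s, 'd, 'p) gmap \<Rightarrow> ('s, 'd, 'p) vmap \<Rightarrow> nat \<Rightarrow> ('s, 'd, 'p) pgm \<Rightarrow> 'p vertex set" where
  "dom_R F R m X = {v \<in> V X. in_disk m (F X) (R X v)}"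

definition graph_R ::
    "('s, 'd, 'p) gmap \<Rightarrow> ('s, 'd, 'p) vmap \<Rightarrow> nat \<Rightarrow> nat \<Rightarrow> ('s, 'd, 'p) pgm
      \<Rightarrow> ('p vertex \<times> 'p vertex) set" where
  "graph_R F R n m X =
     (\<lambda>v. (v \<inter> paths (disk n X), R X v \<inter> paths (disk m (F X)))) ` dom_R F R m X"

text \<open>
  Continuity: \<open>F X\<close> and \<open>R X\<close> are determined up to radius \<open>m\<close> by the disk of \<open>X\<close> of radius \<open>n\<close>. As the
  disk itself does not in general belong to \<open>S\<close>, the value of the dynamics on the disk is read as its
  value on any \<open>X'\<close> in \<open>S\<close> having this same disk.
\<close>

definition continuous_dyn ::
    "('s, 'd, 'p) pgm set \<Rightarrow> ('s, 'd, 'p) gmap \<Rightarrow> ('s, 'd, 'p) vmap \<Rightarrow> bool" where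
  "continuous_dyn S F R \<longleftrightarrow>
     (\<forall>X\<in>S. \<forall>m. \<exists>n. \<forall>X'\<in>S. disk n X' = disk n X \<longrightarrow>
        disk m (F X) = disk m (F X') \<and>
        (\<forall>v\<in>dom_R F R m X. in_disk n X v) \<and>
        (\<forall>v\<in>dom_R F R m X'. in_disk n X' v) \<and>
        graph_R F R n m X = graph_R F R n m X')"

definition shift_invariant ::
    "('s, 'd, 'p) pgm set \<Rightarrow> ('s, 'd, 'p) gmap \<Rightarrow> ('s, 'd, 'p) vmap \<Rightarrow> bool" where
  "shift_invariant S F R \<longleftrightarrow>
     (\<forall>X\<in>S. \<forall>u\<in>V X.
        F (shift X u) = shift (F X) (R X u) \<and>
        (\<forall>v\<in>V (shift X u). R X (conc X u v) = conc (F X) (R X u) (R (shift X u) v)))"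

definition bounded_dyn ::
    "('s, 'd, 'p) pgm set \<Rightarrow> ('s, 'd, 'p) gmap \<Rightarrow> ('s, 'd, 'p) vmap \<Rightarrow> bool" where
  "bounded_dyn S F R \<longleftrightarrow>
     (\<exists>b. \<forall>X\<in>S. \<forall>w'\<in>V (F X). \<exists>u'\<in>R X ` V X. \<exists>v'\<in>V (disk b (shift (F X) u')).
        w' = conc (F X) u' v')"

definition CGD ::
    "('s, 'd, 'p) pgm set \<Rightarrow> ('s, 'd, 'p) gmap \<Rightarrow> ('s, 'd, 'p) vmap \<Rightarrow> bool" where
  "CGD S F R \<longleftrightarrow>
     dynamics S F R \<and> continuous_dyn S F R \<and> shift_invariant S F R \<and> bounded_dyn S F R"

definition vertex_preserving ::
    "('s, 'd, 'p) pgm set \<Rightarrow> ('s, 'd, 'p) gmap \<Rightarrow> ('s, 'd, 'p) vmap \<Rightarrow> bool" where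
  "vertex_preserving S F R \<longleftrightarrow> (\<forall>X\<in>S. bij_betw (R X) (V X) (V (F X)))"


section \<open>Invisible matter\<close>

text \<open>
  The fresh label \<open>m\<close> and the fresh, pairwise distinct ports \<open>m\<close>, \<open>l\<close>, \<open>r\<close>.
\<close>

datatype 's mlabel = Label 's | Label_m
datatype 'p mport = Port 'p | Port_m | Port_l | Port_r

abbreviation X_base ::
    "'s set \<Rightarrow> 'd set \<Rightarrow> 'p set \<Rightarrow> ('s mlabel, 'd, 'p mport) pgm set" where
  "X_base \<Sigma> \<Delta> \<pi> \<equiv> pgms (Label ` \<Sigma>) \<Delta> (Port ` \<pi>)"

abbreviation X_ext ::
    "'s set \<Rightarrow> 'd set \<Rightarrow> 'p set \<Rightarrow> ('s mlabel, 'd, 'p mport) pgm set" where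
  "X_ext \<Sigma> \<Delta> \<pi> \<equiv> pgms (Label ` \<Sigma> \<union> {Label_m}) \<Delta> (Port ` \<pi> \<union> {Port_m, Port_l, Port_r})"

text \<open>
  The edges of the infinite binary tree \<open>T\<close>: a node is the word of left (\<open>False\<close>) and right (\<open>True\<close>) turns leading
  to it from the root.
\<close>

definition tree_edges :: "(bool list \<times> 'p mport) set set" where
  "tree_edges =
     (\<Union>s. {{(s, Port_l), (s @ [False], Port_m)}, {(s, Port_r), (s @ [True], Port_m)}})"

text \<open>
  One copy of \<open>T\<close> attached to each vertex: \<open>Inl v\<close> is the vertex \<open>v\<close> of \<open>G\<close>, and \<open>Inr (v, s)\<close> is the
  node \<open>s\<close> of the copy attached to \<open>v\<close>, with the vertex label \<open>m\<close>. Edges of \<open>T\<close> and the edges linking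
  \<open>T\<close> to \<open>G\<close> carry no label.
\<close>

definition attach_graph ::
    "('v, 's mlabel, 'd, 'p mport) pgraph \<Rightarrow> ('v + 'v \<times> bool list, 's mlabel, 'd, 'p mport) pgraph"
  where
  "attach_graph G = \<lparr>
     verts = Inl ` verts G \<union> Inr ` (verts G \<times> UNIV),
     edges = (\<lambda>e. map_prod Inl id ` e) ` edges G
       \<union> (\<Union>v\<in>verts G. (\<lambda>e. map_prod (\<lambda>s. Inr (v, s)) id ` e) ` tree_edges)
       \<union> (\<Union>v\<in>verts G. {{(Inl v, Port_m), (Inr (v, []), Port_m)}}),
     vlab = (\<lambda>x. case x of Inl v \<Rightarrow> vlab G v
                  | Inr (v, s) \<Rightarrow> if v \<in> verts G then Some Label_m else None),
     elab = (\<lambda>e. if e \<in> (\<lambda>e. map_prod Inl id ` e) ` edges G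
                 then elab G (map_prod projl id ` e) else None),
     ptr = Inl (ptr G)\<rparr>"

definition attach :: "('s mlabel, 'd, 'p mport) pgm \<Rightarrow> ('s mlabel, 'd, 'p mport) pgm" where
  "attach X = (\<Union>G\<in>X. iso_class (attach_graph G))"

definition Y_set ::
    "'s set \<Rightarrow> 'd set \<Rightarrow> 'p set \<Rightarrow> ('s mlabel, 'd, 'p mport) pgm set" where
  "Y_set \<Sigma> \<Delta> \<pi> = {shift (attach X) u | X u. X \<in> X_base \<Sigma> \<Delta> \<pi> \<and> u \<in> V (attach X)}"

definition Y_closure ::
    "'s set \<Rightarrow> 'd set \<Rightarrow> 'p set \<Rightarrow> ('s mlabel, 'd, 'p mport) pgm set" where
  "Y_closure \<Sigma> \<Delta> \<pi> =
     {Y' \<in> X_ext \<Sigma> \<Delta> \<pi>. \<forall>r. \<exists>Y\<in>Y_set \<Sigma> \<Delta> \<pi>. disk r Y = disk r Y'}"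

definition tree_words :: "'p mport path set" where
  "tree_words = lists {(Port_l, Port_m), (Port_r, Port_m)}"

definition matter_shift ::
    "('s mlabel, 'd, 'p mport) pgm \<Rightarrow> 'p mport path \<Rightarrow> ('s mlabel, 'd, 'p mport) pgm" where
  "matter_shift X s = shift (attach X) (vtx (attach X) ((Port_m, Port_m) # s))"

text \<open>
  This is a condition on a dynamics over some superset of \<open>Y_set \<Sigma> \<Delta> \<pi>\<close>; only its values on
  \<open>Y_set \<Sigma> \<Delta> \<pi>\<close> occur.
\<close>

definition invisible_matter_quiescent ::
    "'s set \<Rightarrow> 'd set \<Rightarrow> 'p set \<Rightarrow> ('s mlabel, 'd, 'p mport) gmap
      \<Rightarrow> ('s mlabel, 'd, 'p mport) vmap \<Rightarrow> bool" where
  "invisible_matter_quiescent \<Sigma> \<Delta> \<pi> F R \<longleftrightarrow>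
     (\<exists>b. \<forall>X\<in>X_base \<Sigma> \<Delta> \<pi>. \<forall>s\<in>tree_words. \<forall>t\<in>tree_words. b \<le> length s \<longrightarrow>
        R (matter_shift X s) (vtx (matter_shift X s) t) = vtx (F (matter_shift X s)) t)"

definition IMCGD ::
    "'s set \<Rightarrow> 'd set \<Rightarrow> 'p set \<Rightarrow> ('s mlabel, 'd, 'p mport) gmap
      \<Rightarrow> ('s mlabel, 'd, 'p mport) vmap \<Rightarrow> bool" where
  "IMCGD \<Sigma> \<Delta> \<pi> F R \<longleftrightarrow>
     CGD (Y_set \<Sigma> \<Delta> \<pi>) F R \<and> vertex_preserving (Y_set \<Sigma> \<Delta> \<pi>) F R \<and>
     invisible_matter_quiescent \<Sigma> \<Delta> \<pi> F R"

definition extension_to_closure ::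
    "'s set \<Rightarrow> 'd set \<Rightarrow> 'p set \<Rightarrow> ('s mlabel, 'd, 'p mport) gmap
      \<Rightarrow> ('s mlabel, 'd, 'p mport) vmap \<Rightarrow> ('s mlabel, 'd, 'p mport) gmap
      \<Rightarrow> ('s mlabel, 'd, 'p mport) vmap \<Rightarrow> bool" where
  "extension_to_closure \<Sigma> \<Delta> \<pi> F R F' R' \<longleftrightarrow>
     dynamics (Y_closure \<Sigma> \<Delta> \<pi>) F' R' \<and>
     (\<forall>Y\<in>Y_set \<Sigma> \<Delta> \<pi>. F' Y = F Y \<and> (\<forall>v\<in>V Y. R' Y v = R Y v))"

end

theory Submission
  imports Defs
begin

text \<open>
  The points of the closure that are not in \<open>Y_set\<close> consist of invisible matter only: the shape of a
  graph with attached trees can be recognised locally, so a limit having some vertex not labelled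
  \<open>m\<close> is again a graph with attached trees. Extend the dynamics by the identity on the new points.
  Quiescence together with shift invariance forces the given dynamics to act as the identity around
  every vertex at large depth in the attached trees: such a vertex lies below a vertex of depth \<open>b\<close>,
  whose whole subtree is mapped onto the subtree below its image. So the extension is continuous at
  the new points, and at an old point a disk that reaches a vertex not labelled \<open>m\<close> keeps all
  new points away.
\<close>

section \<open>Walks\<close>

text \<open>Continuity of the given dynamics provides one radius per point of \<open>Y_set\<close>,
  and nothing keeps these radii bounded along a sequence converging to a new point, so it cannot
  supply a radius there. The bound in the quiescence condition is common to all graphs, and this
  uniformity yields the radius \<open>q + Suc m\<close> at a new point: depth \<open>q\<close> for
  quiescence, and \<open>Suc m\<close> more because a disk of radius \<open>m\<close> has vertices
  up to distance \<open>m + 1\<close>. Two gaps have to be closed. Quiescence constrains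
  \<open>R\<close> along tree words but says nothing of the shape of \<open>F X\<close>: that a deep
  vertex is sent into a tree is inferred from the ports \<open>l\<close> and \<open>r\<close>, which
  vertices not labelled \<open>m\<close> do not have. Nor does quiescence exclude that a remote
  vertex is sent into the disk under consideration; injectivity of \<open>R\<close> does. Limits
  made of matter alone do occur: the local conditions let the ascent from child to parent go on
  forever. A single vertex not labelled \<open>m\<close> ends every ascent, because the graph is
  connected.\<close>

lemma edge_verts:
  assumes "pointed_graph G" "e \<in> edges G" "(u, a) \<in> e"
  shows "u \<in> verts G"
proof -
  have "fst ` e \<subseteq> verts G" using assms(1,2) by (simp add: pointed_graph_def)
  then show ?thesis using assms(3) by force
qed

lemma edge_eqI:
  assumes "pointed_graph G" "e \<in> edges G" "e' \<in> edges G" "x \<in> e" "x \<in> e'"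
  shows "e = e'"
proof -
  have "\<forall>e\<in>edges G. \<forall>e'\<in>edges G. e \<inter> e' \<noteq> {} \<longrightarrow> e = e'"
    using assms(1) by (simp add: pointed_graph_def)
  then show ?thesis using assms by blast
qed

lemma edge_unique:
  assumes "pointed_graph G" "{(u, a), (x, b)} \<in> edges G" "{(u, a), (y, c)} \<in> edges G"
  shows "x = y \<and> b = c"
proof -
  have "{(u, a), (x, b)} = {(u, a), (y, c)}"
    by (rule edge_eqI[OF assms, of "(u, a)"]) auto
  then show ?thesis by (auto simp: doubleton_eq_iff)
qed

lemma edgeE:
  assumes "pointed_graph G" "e \<in> edges G"
  obtains u a v b where "e = {(u, a), (v, b)}" "(u, a) \<noteq> (v, b)" "u \<in> verts G" "v \<in> verts G"
proof -
  have "card e = 2" using assms by (simp add: pointed_graph_def)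
  then obtain p q where e: "e = {p, q}" "p \<noteq> q" by (auto simp: card_2_iff)
  obtain u a v b where "p = (u, a)" "q = (v, b)" by fastforce
  then show ?thesis
    using that e edge_verts[OF assms, of u a] edge_verts[OF assms, of v b] by auto
qed

lemma edge_atE:
  assumes "pointed_graph G" "e \<in> edges G" "(u, a) \<in> e"
  obtains v b where "e = {(u, a), (v, b)}"
proof -
  obtain x c y d where "e = {(x, c), (y, d)}" by (rule edgeE[OF assms(1,2)])
  then show ?thesis using assms(3) that by (auto simp: insert_commute)
qed

lemma walk_verts:
  assumes "pointed_graph G" "walk G w u v"
  shows "u \<in> verts G \<and> v \<in> verts G"
  using assms(2)
proof (induction w arbitrary: u)
  case (Cons c w)
  then obtain x where "{(u, fst c), (x, snd c)} \<in> edges G" "walk G w x v" by auto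
  then show ?case using Cons.IH edge_verts[OF assms(1)] by blast
qed auto

lemma walk_append:
  assumes "pointed_graph G"
  shows "walk G (w @ w') u v \<longleftrightarrow> (\<exists>x. walk G w u x \<and> walk G w' x v)"
proof (induction w arbitrary: u)
  case Nil
  then show ?case using walk_verts[OF assms] by auto
qed auto

lemma walk_det:
  assumes "pointed_graph G" "walk G w u v" "walk G w u v'"
  shows "v = v'"
  using assms(2,3)
proof (induction w arbitrary: u)
  case (Cons c w)
  then show ?case using edge_unique[OF assms(1)] by (metis walk.simps(2))
qed auto

lemma walk_trans: "walk G w u x \<Longrightarrow> walk G w' x v \<Longrightarrow> walk G (w @ w') u v"
  by (induction w arbitrary: u) auto

lemma walk_rev:
  assumes "\<And>e. e \<in> edges G \<Longrightarrow> fst ` e \<subseteq> verts G" "walk G w u v"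
  shows "walk G (map prod.swap (rev w)) v u"
  using assms(2)
proof (induction w arbitrary: u)
  case (Cons c w)
  then obtain x where x: "{(u, fst c), (x, snd c)} \<in> edges G" "walk G w x v" by auto
  have "u \<in> verts G" using assms(1)[OF x(1)] by simp
  then have "walk G [prod.swap c] x u" using x(1) by (simp add: insert_commute)
  with Cons.IH[OF x(2)] have "walk G (map prod.swap (rev w) @ [prod.swap c]) v u" by (rule walk_trans)
  then show ?case by simp
qed auto

text \<open>Edges are unordered, so walks can be reversed and joined at \<open>c\<close>. Only the
  incidence of edges is assumed, because the lemma serves to establish \<open>pointed_graph\<close>
  itself.\<close>

lemma connectedI:
  assumes "\<And>e. e \<in> edges G \<Longrightarrow> fst ` e \<subseteq> verts G"
    and "\<And>x. x \<in> verts G \<Longrightarrow> \<exists>w. walk G w c x"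
  shows "\<forall>u\<in>verts G. \<forall>v\<in>verts G. \<exists>w. walk G w u v"
proof (intro ballI)
  fix u v assume "u \<in> verts G" "v \<in> verts G"
  then obtain w w' where "walk G w c u" "walk G w' c v" using assms(2) by blast
  then show "\<exists>w. walk G w u v" using walk_trans[OF walk_rev[OF assms(1)]] by blast
qed

lemma walk_ptr [simp]: "walk (G\<lparr>ptr := x\<rparr>) w u v \<longleftrightarrow> walk G w u v"
  by (induction w arbitrary: u) auto

lemma pointed_graph_ptr:
  "pointed_graph G \<Longrightarrow> x \<in> verts G \<Longrightarrow> pointed_graph (G\<lparr>ptr := x\<rparr>)"
  by (simp add: pointed_graph_def)

lemma ptr_in_verts: "pointed_graph G \<Longrightarrow> ptr G \<in> verts G"
  by (simp add: pointed_graph_def)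

lemma connectedE:
  assumes "pointed_graph G" "u \<in> verts G" "v \<in> verts G"
  obtains w where "walk G w u v"
proof -
  have "\<forall>u\<in>verts G. \<forall>v\<in>verts G. \<exists>w. walk G w u v"
    using assms(1) by (simp add: pointed_graph_def)
  then show ?thesis using that assms(2,3) by blast
qed

section \<open>Isomorphisms\<close>

lemma iso_verts: "pgraph_iso f G H \<Longrightarrow> v \<in> verts G \<Longrightarrow> f v \<in> verts H"
  by (auto simp: pgraph_iso_def bij_betw_def)

lemma iso_inj: "pgraph_iso f G H \<Longrightarrow> u \<in> verts G \<Longrightarrow> v \<in> verts G \<Longrightarrow> f u = f v \<longleftrightarrow> u = v"
  by (auto simp: pgraph_iso_def bij_betw_def inj_on_def)

lemma iso_surj:
  assumes "pgraph_iso f G H" "y \<in> verts H"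
  obtains x where "x \<in> verts G" "y = f x"
proof -
  have "y \<in> f ` verts G" using assms by (simp add: pgraph_iso_def bij_betw_def)
  then show ?thesis using that by blast
qed

lemma iso_edge_image: "pgraph_iso f G H \<Longrightarrow> e \<in> edges G \<Longrightarrow> map_prod f id ` e \<in> edges H"
  unfolding pgraph_iso_def by blast

lemma iso_edge:
  assumes f: "pgraph_iso f G H" and G: "pointed_graph G" and uv: "u \<in> verts G" "v \<in> verts G"
  shows "{(f u, a), (f v, b)} \<in> edges H \<longleftrightarrow> {(u, a), (v, b)} \<in> edges G"
proof
  assume "{(u, a), (v, b)} \<in> edges G"
  then have "map_prod f id ` {(u, a), (v, b)} \<in> edges H"
    by (rule iso_edge_image[OF f])
  then show "{(f u, a), (f v, b)} \<in> edges H" by simp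
next
  assume "{(f u, a), (f v, b)} \<in> edges H"
  then obtain e where e: "e \<in> edges G" "{(f u, a), (f v, b)} = map_prod f id ` e"
    using f by (auto simp: pgraph_iso_def)
  obtain x c y d where xy: "e = {(x, c), (y, d)}" "x \<in> verts G" "y \<in> verts G"
    by (rule edgeE[OF G e(1)])
  then have "{(f u, a), (f v, b)} = {(f x, c), (f y, d)}" using e by simp
  then have "{(u, a), (v, b)} = {(x, c), (y, d)}"
    using iso_inj[OF f] uv xy by (auto simp: doubleton_eq_iff)
  then show "{(u, a), (v, b)} \<in> edges G" using e xy by simp
qed

lemma iso_edgeE:
  assumes "pgraph_iso f G H" "pointed_graph G" "e \<in> edges H"
  obtains u a v b where "e = {(f u, a), (f v, b)}" "u \<in> verts G" "v \<in> verts G"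
    "{(u, a), (v, b)} \<in> edges G"
proof -
  obtain e' where e': "e' \<in> edges G" "e = map_prod f id ` e'"
    using assms by (auto simp: pgraph_iso_def)
  obtain u a v b where "e' = {(u, a), (v, b)}" "u \<in> verts G" "v \<in> verts G"
    by (rule edgeE[OF assms(2) e'(1)])
  then show ?thesis using that e' by simp
qed

lemma iso_walk:
  assumes f: "pgraph_iso f G H" and G: "pointed_graph G" and "u \<in> verts G" "v \<in> verts G"
  shows "walk H w (f u) (f v) \<longleftrightarrow> walk G w u v"
  using assms(3)
proof (induction w arbitrary: u)
  case Nil
  then show ?case using iso_inj[OF f] iso_verts[OF f] assms(4) by auto
next
  case (Cons c w)
  show ?case
  proof
    assume "walk H (c # w) (f u) (f v)"
    then obtain y where y: "{(f u, fst c), (y, snd c)} \<in> edges H" "walk H w y (f v)" by auto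
    obtain u1 a1 u2 a2 where "{(f u, fst c), (y, snd c)} = {(f u1, a1), (f u2, a2)}"
      "u1 \<in> verts G" "u2 \<in> verts G"
      by (rule iso_edgeE[OF f G y(1)])
    then obtain x where x: "x \<in> verts G" "y = f x" by (auto simp: doubleton_eq_iff)
    then show "walk G (c # w) u v"
      using y Cons iso_edge[OF f G] by auto
  next
    assume "walk G (c # w) u v"
    then obtain x where x: "{(u, fst c), (x, snd c)} \<in> edges G" "walk G w x v" by auto
    have "x \<in> verts G" using x(1) edge_verts[OF G] by blast
    then have "{(f u, fst c), (f x, snd c)} \<in> edges H" "walk H w (f x) (f v)"
      using x Cons iso_edge[OF f G] by auto
    then show "walk H (c # w) (f u) (f v)" by auto
  qed
qed

lemma iso_walk_ptr:
  assumes "pgraph_iso f G H" "pointed_graph G" "v \<in> verts G"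
  shows "walk H w (ptr H) (f v) \<longleftrightarrow> walk G w (ptr G) v"
  using iso_walk[OF assms(1,2) ptr_in_verts[OF assms(2)] assms(3)] assms(1)
  by (simp add: pgraph_iso_def)

lemma iso_walkE:
  assumes f: "pgraph_iso f G H" and "pointed_graph G" "pointed_graph H" "walk H w (ptr H) y"
  obtains x where "x \<in> verts G" "y = f x" "walk G w (ptr G) x"
proof -
  have "y \<in> verts H" using walk_verts[OF assms(3,4)] by simp
  then obtain x where "x \<in> verts G" "y = f x" by (rule iso_surj[OF f])
  then show ?thesis using that iso_walk_ptr[OF assms(1,2)] assms(4) by blast
qed

lemma iso_refl: "pgraph_iso id G G"
  by (simp add: pgraph_iso_def map_prod.id)

lemma iso_ptr:
  "pgraph_iso f G H \<Longrightarrow> pgraph_iso f (G\<lparr>ptr := v\<rparr>) (H\<lparr>ptr := f v\<rparr>)"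
  by (simp add: pgraph_iso_def)

lemma iso_trans:
  assumes "pgraph_iso f G H" "pgraph_iso g H K"
  shows "pgraph_iso (g \<circ> f) G K"
proof -
  have m: "map_prod (g \<circ> f) id ` e = map_prod g id ` map_prod f id ` e" for e :: "('a \<times> 'x) set"
    by (force simp: image_image)
  show ?thesis
    using assms bij_betw_trans[of f "verts G" "verts H" g "verts K"] iso_verts[OF assms(1)]
    by (auto simp: pgraph_iso_def m image_image)
qed

text \<open>The inverse is controlled on \<open>verts G\<close> only. That it also undoes
  \<open>f\<close> on edges rests on the endpoints of edges being vertices, hence the assumption
  \<open>pointed_graph G\<close>.\<close>

lemma iso_sym:
  assumes f: "pgraph_iso f G H" and G: "pointed_graph G"
  shows "pgraph_iso (inv_into (verts G) f) H G"
proof -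
  let ?g = "inv_into (verts G) f"
  have bij: "bij_betw f (verts G) (verts H)" using f by (simp add: pgraph_iso_def)
  have gf: "?g (f v) = v" if "v \<in> verts G" for v
    using that bij by (simp add: bij_betw_inv_into_left)
  have fe: "map_prod ?g id ` map_prod f id ` e = e" if "e \<in> edges G" for e
  proof -
    obtain u a v b where "e = {(u, a), (v, b)}" "u \<in> verts G" "v \<in> verts G"
      by (rule edgeE[OF G \<open>e \<in> edges G\<close>])
    then show ?thesis by (simp add: gf)
  qed
  have eH: "edges H = (\<lambda>e. map_prod f id ` e) ` edges G" using f by (simp add: pgraph_iso_def)
  have "edges G = (\<lambda>e. map_prod ?g id ` e) ` edges H"
    unfolding eH by (subst image_image) (simp add: fe)
  moreover have "\<forall>e\<in>edges H. elab G (map_prod ?g id ` e) = elab H e"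
    using f unfolding eH by (simp add: fe pgraph_iso_def)
  moreover have "\<forall>v\<in>verts H. vlab G (?g v) = vlab H v"
    using f gf by (auto elim!: iso_surj[OF f] simp: pgraph_iso_def)
  ultimately show ?thesis
    using f G bij_betw_inv_into[OF bij] gf by (simp add: pgraph_iso_def ptr_in_verts)
qed

text \<open>An embedding is onto as soon as the domain uses all ports that the codomain uses.\<close>

lemma isoI_ports:
  assumes G: "pointed_graph G" and H: "pointed_graph H"
    and bij: "bij_betw f (verts G) (verts H)"
    and sub: "\<And>e. e \<in> edges G \<Longrightarrow> map_prod f id ` e \<in> edges H"
    and ports: "\<And>e u a. e \<in> edges H \<Longrightarrow> u \<in> verts G \<Longrightarrow> (f u, a) \<in> e \<Longrightarrow> \<exists>e'\<in>edges G. (u, a) \<in> e'"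
    and vlab: "\<And>v. v \<in> verts G \<Longrightarrow> vlab H (f v) = vlab G v"
    and elab: "\<And>e. e \<in> edges G \<Longrightarrow> elab H (map_prod f id ` e) = elab G e"
    and ptr: "ptr H = f (ptr G)"
  shows "pgraph_iso f G H"
proof -
  have "e \<in> (\<lambda>e. map_prod f id ` e) ` edges G" if "e \<in> edges H" for e
  proof -
    obtain x a y b where e: "e = {(x, a), (y, b)}" "x \<in> verts H" "y \<in> verts H"
      by (rule edgeE[OF H \<open>e \<in> edges H\<close>])
    then obtain u where u: "u \<in> verts G" "x = f u" using bij by (auto simp: bij_betw_def)
    then obtain e' where e': "e' \<in> edges G" "(u, a) \<in> e'" using ports[OF \<open>e \<in> edges H\<close>, of u a] e by auto
    \<comment> \<open>Both edges pass through the vertex-port pair \<open>(x, a)\<close>, and such a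
      pair lies in at most one edge of \<open>H\<close>.\<close>
    have "e = map_prod f id ` e'"
    proof (rule edge_eqI[OF H \<open>e \<in> edges H\<close> sub[OF e'(1)]])
      show "(x, a) \<in> map_prod f id ` e'" using e'(2) u(2) by force
    qed (simp add: e)
    then show ?thesis using e' by blast
  qed
  then have "edges H = (\<lambda>e. map_prod f id ` e) ` edges G" using sub by blast
  then show ?thesis using bij vlab elab ptr by (simp add: pgraph_iso_def)
qed

lemma over_alphabets_iso:
  assumes f: "pgraph_iso f G H" and "pointed_graph G" and H: "pointed_graph H" and G: "over_alphabets \<Sigma> \<Delta> \<pi> G"
  shows "over_alphabets \<Sigma> \<Delta> \<pi> H"
proof -
  have "s \<in> \<Sigma>" if "vlab H y = Some s" for y s
  proof -
    have "y \<in> verts H" using that H by (auto simp: pointed_graph_def)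
    then obtain x where "x \<in> verts G" "y = f x" by (rule iso_surj[OF f])
    then have "vlab G x = Some s" using f that by (simp add: pgraph_iso_def)
    then show ?thesis using G by (auto simp: over_alphabets_def ran_def)
  qed
  moreover have "d \<in> \<Delta>" if "elab H e = Some d" for e d
  proof -
    have "e \<in> edges H" using that H by (auto simp: pointed_graph_def)
    then obtain e' where "e' \<in> edges G" "e = map_prod f id ` e'"
      using f by (auto simp: pgraph_iso_def)
    then have "elab G e' = Some d" using f that by (simp add: pgraph_iso_def)
    then show ?thesis using G by (auto simp: over_alphabets_def ran_def)
  qed
  moreover have "snd ` e \<subseteq> \<pi>" if "e \<in> edges H" for e
  proof -
    obtain e' where "e' \<in> edges G" "e = map_prod f id ` e'"
      using f \<open>e \<in> edges H\<close> by (auto simp: pgraph_iso_def)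
    moreover from this have "snd ` e = snd ` e'" by force
    ultimately show ?thesis using G by (simp add: over_alphabets_def)
  qed
  ultimately show ?thesis by (auto simp: over_alphabets_def ran_def)
qed

text \<open>Transport of structure along an injection. It carries graphs such as
  \<open>attach_graph G\<close>, whose vertices are not numbers, to graphs on \<open>nat\<close>,
  the only possible members of a class. Labels are \<open>None\<close> off the image so that the
  domain conditions of \<open>pointed_graph\<close> hold.\<close>

definition map_graph :: "('v \<Rightarrow> 'w) \<Rightarrow> ('v, 's, 'd, 'p) pgraph \<Rightarrow> ('w, 's, 'd, 'p) pgraph" where
  "map_graph f G = \<lparr>
     verts = f ` verts G,
     edges = (\<lambda>e. map_prod f id ` e) ` edges G,
     vlab = (\<lambda>y. if y \<in> f ` verts G then vlab G (inv_into (verts G) f y) else None),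
     elab = (\<lambda>e. if e \<in> (\<lambda>e. map_prod f id ` e) ` edges G
                 then elab G (map_prod (inv_into (verts G) f) id ` e) else None),
     ptr = f (ptr G)\<rparr>"

lemma iso_map_graph:
  assumes G: "pointed_graph G" and inj: "inj_on f (verts G)"
  shows "pgraph_iso f G (map_graph f G)"
proof -
  have fe: "map_prod (inv_into (verts G) f) id ` map_prod f id ` e = e" if "e \<in> edges G" for e
  proof -
    obtain u a v b where "e = {(u, a), (v, b)}" "u \<in> verts G" "v \<in> verts G"
      by (rule edgeE[OF G \<open>e \<in> edges G\<close>])
    then show ?thesis by (simp add: inj)
  qed
  show ?thesis using inj by (auto simp: pgraph_iso_def map_graph_def bij_betw_def fe)
qed

lemma pointed_graph_map_graph:
  assumes G: "pointed_graph G" and inj: "inj_on f (verts G)"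
  shows "pointed_graph (map_graph f G)"
proof -
  let ?H = "map_graph f G"
  note f = iso_map_graph[OF assms]
  have "card e = 2 \<and> fst ` e \<subseteq> verts ?H" if e: "e \<in> edges ?H" for e
  proof -
    obtain e' where e': "e' \<in> edges G" "e = map_prod f id ` e'"
      using f e by (auto simp: pgraph_iso_def)
    obtain u a v b where "e' = {(u, a), (v, b)}" "(u, a) \<noteq> (v, b)" "u \<in> verts G" "v \<in> verts G"
      by (rule edgeE[OF G e'(1)])
    then show ?thesis using e' iso_inj[OF f] iso_verts[OF f] by (auto simp: card_2_iff)
  qed
  moreover have "e = e'" if e: "e \<in> edges ?H" "e' \<in> edges ?H" "e \<inter> e' \<noteq> {}" for e e'
  proof -
    obtain d d' where d: "d \<in> edges G" "e = map_prod f id ` d" "d' \<in> edges G" "e' = map_prod f id ` d'"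
      using f e(1,2) by (auto simp: pgraph_iso_def)
    obtain u a u' where "(u, a) \<in> d" "(u', a) \<in> d'" "f u = f u'" using e(3) d(2,4) by auto
    then have "d = d'"
      using d edge_eqI[OF G, of d d' "(u, a)"] edge_verts[OF G, of d u a] edge_verts[OF G, of d' u' a]
        iso_inj[OF f, of u u'] by simp
    then show ?thesis using d by simp
  qed
  moreover have "dom (vlab ?H) \<subseteq> verts ?H" "dom (elab ?H) \<subseteq> edges ?H"
    by (auto simp: map_graph_def split: if_splits)
  moreover have "\<exists>w. walk ?H w x y" if xy: "x \<in> verts ?H" "y \<in> verts ?H" for x y
  proof -
    obtain u v where "u \<in> verts G" "x = f u" "v \<in> verts G" "y = f v"
      using xy by (auto simp: map_graph_def)
    then show ?thesis using iso_walk[OF f G] connectedE[OF G, of u v] by metis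
  qed
  moreover have "countable (verts ?H)" "ptr ?H \<in> verts ?H"
    using G by (auto simp: map_graph_def pointed_graph_def)
  ultimately show ?thesis by (auto simp: pointed_graph_def)
qed

section \<open>Isomorphism classes\<close>

lemma iso_class_self: "pointed_graph G \<Longrightarrow> G \<in> iso_class G"
  using iso_refl by (auto simp: iso_class_def)

lemma iso_class_eqI:
  assumes f: "pgraph_iso f G H" and G: "pointed_graph G"
  shows "iso_class G = iso_class H"
proof -
  have "\<exists>g. pgraph_iso g H K" if "pgraph_iso g G K" for g K
    using iso_trans[OF iso_sym[OF f G] that] by blast
  moreover have "\<exists>g. pgraph_iso g G K" if "pgraph_iso g H K" for g K
    using iso_trans[OF f that] by blast
  ultimately show ?thesis by (auto simp: iso_class_def)
qed

lemma iso_class_memberE: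
  assumes "H \<in> iso_class G"
  obtains f where "pgraph_iso f G H" "pointed_graph H"
  using assms by (auto simp: iso_class_def)

text \<open>Guarantees that the class of a graph over any vertex type is nonempty. Without a member
  on \<open>nat\<close>, the unions defining \<open>shift\<close>, \<open>disk\<close> and
  \<open>attach\<close> would collapse to the empty set.\<close>

lemma nat_representative:
  assumes "pointed_graph G"
  obtains H :: "(nat, 's, 'd, 'p) pgraph" and f
  where "pointed_graph H" "pgraph_iso f G H" "iso_class G = iso_class H"
proof -
  have "countable (verts G)" using assms by (simp add: pointed_graph_def)
  then obtain f :: "_ \<Rightarrow> nat" where "inj_on f (verts G)" by (auto simp: countable_def)
  then show ?thesis
    using that pointed_graph_map_graph[OF assms] iso_map_graph[OF assms]
      iso_class_eqI[OF _ assms] by blast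
qed

text \<open>The vertex types of \<open>G\<close> and \<open>H\<close> may differ and neither graph
  need belong to its own class, so the isomorphism is composed through a common member
  \<open>K\<close> on \<open>nat\<close>.\<close>

lemma iso_class_eqD:
  assumes "iso_class G = iso_class H" "pointed_graph G" "pointed_graph H"
  shows "\<exists>f. pgraph_iso f G H"
proof -
  obtain K :: "(nat, _, _, _) pgraph" and g where K: "pointed_graph K" "pgraph_iso g H K"
    by (rule nat_representative[OF assms(3)])
  then have "K \<in> iso_class G" using assms(1) by (auto simp: iso_class_def)
  then obtain f where "pgraph_iso f G K" by (auto simp: iso_class_def)
  then show ?thesis using iso_trans[OF _ iso_sym[OF K(2) assms(3)]] by blast
qed

section \<open>Vertices of a class, computed as path sets in one representative\<close>

definition paths_to :: "('v, 's, 'd, 'p) pgraph \<Rightarrow> 'v \<Rightarrow> 'p vertex" where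
  "paths_to G v = {w. walk G w (ptr G) v}"

lemma paths_to_nonempty: "pointed_graph G \<Longrightarrow> v \<in> verts G \<Longrightarrow> paths_to G v \<noteq> {}"
  by (auto simp: paths_to_def pointed_graph_def)

text \<open>Walks are deterministic, so path sets of distinct vertices are disjoint, and by
  connectedness they are nonempty.\<close>

lemma paths_to_inj:
  assumes "pointed_graph G" "u \<in> verts G" "v \<in> verts G"
  shows "paths_to G u = paths_to G v \<longleftrightarrow> u = v"
  using paths_to_nonempty[OF assms(1,2)] walk_det[OF assms(1)] unfolding paths_to_def by blast

lemma paths_iso_class:
  assumes G: "pointed_graph G"
  shows "paths (iso_class G) = {w. \<exists>v. walk G w (ptr G) v}"
proof -
  obtain H :: "(nat, _, _, _) pgraph" and f
    where H: "pointed_graph H" "pgraph_iso f G H" "iso_class G = iso_class H"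
    by (rule nat_representative[OF G])
  have "\<exists>v. walk G w (ptr G) v" if w: "w \<in> paths (iso_class G)" for w
  proof -
    obtain K y where K: "K \<in> iso_class G" and y: "walk K w (ptr K) y"
      using w by (auto simp: paths_def)
    obtain g where "pgraph_iso g G K" "pointed_graph K" by (rule iso_class_memberE[OF K])
    then show ?thesis using iso_walkE[OF _ G _ y] by metis
  qed
  moreover have "w \<in> paths (iso_class G)" if w: "walk G w (ptr G) v" for w v
  proof -
    have "walk H w (ptr H) (f v)"
      using iso_walk_ptr[OF H(2) G] w walk_verts[OF G w] by blast
    then show ?thesis using iso_class_self[OF H(1)] H(3) by (auto simp: paths_def)
  qed
  ultimately show ?thesis by blast
qed

lemma vtx_iso_class:
  assumes G: "pointed_graph G" and w: "walk G w (ptr G) v"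
  shows "vtx (iso_class G) w = paths_to G v"
proof -
  have v: "v \<in> verts G" using walk_verts[OF G w] by simp
  obtain H :: "(nat, _, _, _) pgraph" and f
    where H: "pointed_graph H" "pgraph_iso f G H" "iso_class G = iso_class H"
    by (rule nat_representative[OF G])
  have "walk G w' (ptr G) v" if w': "w' \<in> vtx (iso_class G) w" for w'
  proof -
    obtain K y where K: "K \<in> iso_class G" and y: "walk K w (ptr K) y" "walk K w' (ptr K) y"
      using w' by (auto simp: vtx_def)
    obtain g where g: "pgraph_iso g G K" "pointed_graph K" by (rule iso_class_memberE[OF K])
    obtain x where "x \<in> verts G" "y = g x" "walk G w (ptr G) x"
      by (rule iso_walkE[OF g(1) G g(2) y(1)])
    then show ?thesis using y(2) iso_walk_ptr[OF g(1) G] walk_det[OF G w] by blast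
  qed
  moreover have "w' \<in> vtx (iso_class G) w" if w': "walk G w' (ptr G) v" for w'
  proof -
    have "walk H w (ptr H) (f v)" "walk H w' (ptr H) (f v)"
      using iso_walk_ptr[OF H(2) G v] w w' by auto
    then show ?thesis using iso_class_self[OF H(1)] H(3) by (auto simp: vtx_def)
  qed
  ultimately show ?thesis by (auto simp: paths_to_def)
qed

lemma vtx_nonempty: "vtx X w \<noteq> {} \<Longrightarrow> w \<in> paths X"
  by (auto simp: vtx_def paths_def)

lemma V_iso_class:
  assumes G: "pointed_graph G"
  shows "V (iso_class G) = paths_to G ` verts G"
proof (intro equalityI subsetI)
  fix x assume "x \<in> V (iso_class G)"
  then show "x \<in> paths_to G ` verts G"
    using vtx_iso_class[OF G] walk_verts[OF G] by (auto simp: V_def paths_iso_class[OF G])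
next
  fix x assume "x \<in> paths_to G ` verts G"
  then obtain v where v: "v \<in> verts G" "x = paths_to G v" by blast
  obtain w where w: "walk G w (ptr G) v" by (rule connectedE[OF G ptr_in_verts[OF G] v(1)])
  then show "x \<in> V (iso_class G)"
    using v vtx_iso_class[OF G w] by (auto simp: V_def paths_iso_class[OF G])
qed

lemma shift_iso_class:
  assumes G: "pointed_graph G" and v: "v \<in> verts G"
  shows "shift (iso_class G) (paths_to G v) = iso_class (G\<lparr>ptr := v\<rparr>)"
proof -
  have eq: "iso_class (K\<lparr>ptr := y\<rparr>) = iso_class (G\<lparr>ptr := v\<rparr>)"
    if K: "K \<in> iso_class G" and w: "w \<in> paths_to G v" "walk K w (ptr K) y" for K w y
  proof -
    obtain g where g: "pgraph_iso g G K" "pointed_graph K" by (rule iso_class_memberE[OF K])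
    obtain x where "x \<in> verts G" "y = g x" "walk G w (ptr G) x"
      by (rule iso_walkE[OF g(1) G g(2) w(2)])
    then have "y = g v" using w(1) walk_det[OF G] by (auto simp: paths_to_def)
    then show ?thesis
      using iso_class_eqI[OF iso_ptr[OF g(1)] pointed_graph_ptr[OF G v]] by simp
  qed
  \<comment> \<open>By \<open>eq\<close> all terms of the union in \<open>shift\<close> coincide; it
    remains to see that there is at least one.\<close>
  have ex: "\<exists>K\<in>iso_class G. \<exists>w\<in>paths_to G v. \<exists>y. walk K w (ptr K) y"
  proof -
    obtain H :: "(nat, _, _, _) pgraph" and f
      where H: "pointed_graph H" "pgraph_iso f G H" "iso_class G = iso_class H"
      by (rule nat_representative[OF G])
    obtain w where w: "walk G w (ptr G) v" by (rule connectedE[OF G ptr_in_verts[OF G] v(1)])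
    show ?thesis
      using iso_walk_ptr[OF H(2) G v] w iso_class_self[OF H(1)] H(3) by (auto simp: paths_to_def)
  qed
  show ?thesis
  proof (intro equalityI subsetI)
    fix L assume "L \<in> shift (iso_class G) (paths_to G v)"
    then obtain K w y where "K \<in> iso_class G" "w \<in> paths_to G v" "walk K w (ptr K) y"
      "L \<in> iso_class (K\<lparr>ptr := y\<rparr>)"
      unfolding shift_def by blast
    then show "L \<in> iso_class (G\<lparr>ptr := v\<rparr>)" using eq[of K w y] by simp
  next
    fix L assume L: "L \<in> iso_class (G\<lparr>ptr := v\<rparr>)"
    obtain K w y where K: "K \<in> iso_class G" "w \<in> paths_to G v" "walk K w (ptr K) y"
      using ex by blast
    then have "L \<in> iso_class (K\<lparr>ptr := y\<rparr>)" using eq[OF K] L by simp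
    then show "L \<in> shift (iso_class G) (paths_to G v)" using K unfolding shift_def by blast
  qed
qed

text \<open>A single word already determines the endpoint, so \<open>p\<close> may be any nonempty
  part of the path set. This generality is for \<open>bounded_dyn\<close>, where the second factor
  is a vertex of a disk and contains only the words that stay inside the disk.\<close>

lemma conc_iso_class:
  assumes G: "pointed_graph G" and u: "u \<in> verts G" and p: "p \<noteq> {}" "p \<subseteq> paths_to (G\<lparr>ptr := u\<rparr>) v"
  shows "conc (iso_class G) (paths_to G u) p = paths_to G v"
proof -
  have "vtx (iso_class G) (w @ w') = paths_to G v" if "w \<in> paths_to G u" "w' \<in> p" for w w'
  proof -
    have "walk G (w @ w') (ptr G) v"
      using that p(2) by (auto simp: walk_append[OF G] paths_to_def)
    then show ?thesis by (rule vtx_iso_class[OF G])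
  qed
  then have "conc (iso_class G) (paths_to G u) p = (\<Union>w\<in>paths_to G u. \<Union>w'\<in>p. paths_to G v)"
    by (simp add: conc_def)
  then show ?thesis using paths_to_nonempty[OF G u] p(1) by simp
qed

section \<open>Disks\<close>

lemma ball_mono: "j \<le> k \<Longrightarrow> ball_verts G j \<subseteq> ball_verts G k"
  unfolding ball_verts_def using order_trans by blast

lemma ball_verts_subset: "pointed_graph G \<Longrightarrow> ball_verts G k \<subseteq> verts G"
  using walk_verts by (fastforce simp: ball_verts_def)

lemma ptr_in_ball: "pointed_graph G \<Longrightarrow> ptr G \<in> ball_verts G k"
  unfolding ball_verts_def using ptr_in_verts by (force intro: exI[of _ "[]"])

lemma ball_step:
  assumes "pointed_graph G" "v \<in> ball_verts G k" "{(v, a), (x, b)} \<in> edges G"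
  shows "x \<in> ball_verts G (Suc k)"
proof -
  obtain w where w: "length w \<le> k" "walk G w (ptr G) v" using assms(2) by (auto simp: ball_verts_def)
  have "x \<in> verts G" using edge_verts[OF assms(1,3)] by blast
  then have "walk G [(a, b)] v x" using assms(3) by simp
  then have "walk G (w @ [(a, b)]) (ptr G) x" using w walk_append[OF assms(1)] by blast
  then show ?thesis using w(1) by (force simp: ball_verts_def intro: exI[of _ "w @ [(a, b)]"])
qed

lemma in_some_ball:
  assumes "pointed_graph G" "v \<in> verts G"
  obtains k where "v \<in> ball_verts G k"
proof -
  obtain w where "walk G w (ptr G) v" by (rule connectedE[OF assms(1) ptr_in_verts[OF assms(1)] assms(2)])
  then show ?thesis using that[of "length w"] by (auto simp: ball_verts_def)
qed

lemma disk_walk_imp: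
  assumes "pointed_graph G" "walk (disk_graph r G) w u v"
  shows "walk G w u v"
  using assms(2) ball_verts_subset[OF assms(1)]
  by (induction w arbitrary: u) (auto simp: disk_graph_def)

text \<open>Each step increases the distance from the pointer by at most one. The budget is
  \<open>r + 1\<close> because that is the vertex radius of \<open>disk_graph r\<close>; labels have
  the smaller radius \<open>r\<close>.\<close>

lemma walk_in_disk:
  assumes G: "pointed_graph G"
  shows "u \<in> ball_verts G k \<Longrightarrow> walk G w u v \<Longrightarrow> k + length w \<le> r + 1 \<Longrightarrow> walk (disk_graph r G) w u v"
proof (induction w arbitrary: u k)
  case Nil
  then show ?case using ball_mono[of k "r + 1" G] by (auto simp: disk_graph_def)
next
  case (Cons c w)
  then obtain x where x: "{(u, fst c), (x, snd c)} \<in> edges G" "walk G w x v" by auto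
  have xk: "x \<in> ball_verts G (Suc k)" by (rule ball_step[OF G Cons.prems(1) x(1)])
  then have "walk (disk_graph r G) w x v" using Cons.IH x(2) Cons.prems(3) by simp
  moreover have "u \<in> ball_verts G (r + 1)" "x \<in> ball_verts G (r + 1)"
    using Cons.prems(1,3) xk ball_mono[of k "r + 1" G] ball_mono[of "Suc k" "r + 1" G] by auto
  then have "{(u, fst c), (x, snd c)} \<in> edges (disk_graph r G)"
    using x(1) by (simp add: disk_graph_def)
  ultimately show ?case by auto
qed

lemma ball_disk_graph:
  assumes G: "pointed_graph G" and k: "k \<le> r + 1"
  shows "ball_verts (disk_graph r G) k = ball_verts G k"
proof -
  have "ptr (disk_graph r G) = ptr G" by (simp add: disk_graph_def)
  then show ?thesis
    using disk_walk_imp[OF G] walk_in_disk[OF G ptr_in_ball[OF G, of 0]] k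
    by (fastforce simp: ball_verts_def)
qed

lemma pointed_graph_disk:
  assumes G: "pointed_graph G"
  shows "pointed_graph (disk_graph r G)"
proof -
  let ?D = "disk_graph r G"
  note sub = ball_verts_subset[OF G, of "r + 1"]
  have "\<forall>u\<in>verts ?D. \<forall>v\<in>verts ?D. \<exists>w. walk ?D w u v"
  proof (rule connectedI)
    fix x assume "x \<in> verts ?D"
    then obtain w where "length w \<le> r + 1" "walk G w (ptr G) x"
      by (auto simp: disk_graph_def ball_verts_def)
    then have "walk ?D w (ptr G) x" using walk_in_disk[OF G ptr_in_ball[OF G, of 0]] by simp
    then show "\<exists>w. walk ?D w (ptr G) x" ..
  qed (simp add: disk_graph_def)
  moreover have "countable (verts ?D)"
    using sub G countable_subset by (auto simp: disk_graph_def pointed_graph_def)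
  moreover have "\<forall>e\<in>edges ?D. card e = 2 \<and> fst ` e \<subseteq> verts ?D"
    using G by (simp add: disk_graph_def pointed_graph_def)
  moreover have "\<forall>e\<in>edges ?D. \<forall>e'\<in>edges ?D. e \<inter> e' \<noteq> {} \<longrightarrow> e = e'"
    using G by (simp add: disk_graph_def pointed_graph_def)
  moreover have "dom (vlab ?D) \<subseteq> verts ?D"
    using ball_mono[of r "r + 1" G] by (auto simp: disk_graph_def)
  moreover have "dom (elab ?D) \<subseteq> edges ?D"
  proof -
    have "dom (elab G) \<subseteq> edges G" using G by (simp add: pointed_graph_def)
    then show ?thesis using ball_mono[of r "r + 1" G] by (auto simp: disk_graph_def)
  qed
  moreover have "ptr ?D \<in> verts ?D"
    using ptr_in_ball[OF G] by (simp add: disk_graph_def)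
  ultimately show ?thesis unfolding pointed_graph_def by blast
qed

lemma iso_ball:
  assumes f: "pgraph_iso f G H" and G: "pointed_graph G" and H: "pointed_graph H"
  shows "ball_verts H k = f ` ball_verts G k"
proof (intro equalityI subsetI)
  fix y assume "y \<in> ball_verts H k"
  then obtain w where w: "length w \<le> k" "walk H w (ptr H) y" by (auto simp: ball_verts_def)
  obtain x where "x \<in> verts G" "y = f x" "walk G w (ptr G) x" by (rule iso_walkE[OF f G H w(2)])
  then show "y \<in> f ` ball_verts G k" using w(1) by (auto simp: ball_verts_def)
next
  fix y assume "y \<in> f ` ball_verts G k"
  then obtain w x where "length w \<le> k" "walk G w (ptr G) x" "y = f x" by (auto simp: ball_verts_def)
  then show "y \<in> ball_verts H k"
    using iso_walk_ptr[OF f G] walk_verts[OF G] by (auto simp: ball_verts_def)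
qed

lemma iso_disk:
  assumes f: "pgraph_iso f G H" and G: "pointed_graph G" and H: "pointed_graph H"
  shows "pgraph_iso f (disk_graph r G) (disk_graph r H)"
proof -
  note B = iso_ball[OF f G H]
  note sub = ball_verts_subset[OF G]
  have inj: "inj_on f (verts G)" using f by (simp add: pgraph_iso_def bij_betw_def)
  have in_ball: "f v \<in> ball_verts H k \<longleftrightarrow> v \<in> ball_verts G k" if "v \<in> verts G" for v k
    using that inj sub[of k] unfolding B by (auto dest: inj_onD)
  have fst_map: "fst ` map_prod f id ` e = f ` fst ` e" for e :: "(_ \<times> 'x) set"
    by (force simp: image_image)
  have e_in_ball: "fst ` map_prod f id ` e \<subseteq> ball_verts H k \<longleftrightarrow> fst ` e \<subseteq> ball_verts G k"
    if "e \<in> edges G" for e k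
  proof -
    have "fst ` e \<subseteq> verts G" using that G by (simp add: pointed_graph_def)
    then show ?thesis using in_ball unfolding fst_map by blast
  qed
  have eH: "edges H = (\<lambda>e. map_prod f id ` e) ` edges G" using f by (simp add: pgraph_iso_def)
  have sel: "{e \<in> edges G. fst ` map_prod f id ` e \<subseteq> ball_verts H (r + 1)} = edges (disk_graph r G)"
    by (simp only: disk_graph_def pgraph.select_convs e_in_ball cong: conj_cong)
  have "edges (disk_graph r H) = {e' \<in> (\<lambda>e. map_prod f id ` e) ` edges G. fst ` e' \<subseteq> ball_verts H (r + 1)}"
    by (simp add: disk_graph_def eH)
  then have "edges (disk_graph r H) = (\<lambda>e. map_prod f id ` e) ` edges (disk_graph r G)"
    by (simp only: Compr_image_eq sel)
  moreover have "bij_betw f (verts (disk_graph r G)) (verts (disk_graph r H))"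
    using inj_on_subset[OF inj sub] by (simp add: disk_graph_def B bij_betw_def)
  moreover have "vlab (disk_graph r H) (f v) = vlab (disk_graph r G) v" if "v \<in> verts (disk_graph r G)" for v
  proof -
    have "v \<in> verts G" using that sub by (auto simp: disk_graph_def)
    then show ?thesis using in_ball f by (simp add: disk_graph_def restrict_map_def pgraph_iso_def)
  qed
  moreover have "elab (disk_graph r H) (map_prod f id ` e) = elab (disk_graph r G) e"
    if "e \<in> edges (disk_graph r G)" for e
  proof -
    have "e \<in> edges G" using that by (simp add: disk_graph_def)
    then show ?thesis using e_in_ball f
      by (simp add: disk_graph_def restrict_map_def pgraph_iso_def del: image_subset_iff)
  qed
  ultimately show ?thesis using f by (simp add: pgraph_iso_def disk_graph_def)
qed

text \<open>Both \<open>disk\<close> and \<open>attach\<close> are unions over the members of a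
  class. Such a union is a single class as soon as the construction respects isomorphism, since
  there is a member to begin with.\<close>

lemma UN_iso_class:
  assumes G: "pointed_graph G"
    and h: "\<And>f H. pgraph_iso f G H \<Longrightarrow> pointed_graph H \<Longrightarrow> iso_class (h H) = C"
  shows "(\<Union>H\<in>iso_class G. iso_class (h H)) = C"
proof -
  obtain H :: "(nat, _, _, _) pgraph" and f
    where H: "pointed_graph H" "pgraph_iso f G H" "iso_class G = iso_class H"
    by (rule nat_representative[OF G])
  have "iso_class G \<noteq> {}" using iso_class_self[OF H(1)] H(3) by blast
  moreover have "iso_class (h K) = C" if "K \<in> iso_class G" for K
    by (rule iso_class_memberE[OF that]) (rule h)
  ultimately show ?thesis by (simp cong: SUP_cong_simp)
qed

lemma disk_iso_class:
  fixes G :: "('v, 's, 'd, 'p) pgraph"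
  assumes G: "pointed_graph G"
  shows "disk r (iso_class G) = iso_class (disk_graph r G)"
  unfolding disk_def
proof (rule UN_iso_class[OF G])
  fix f and H :: "(nat, 's, 'd, 'p) pgraph"
  assume "pgraph_iso f G H" "pointed_graph H"
  then show "iso_class (disk_graph r H) = iso_class (disk_graph r G)"
    using iso_class_eqI[OF iso_disk[of f G H r] pointed_graph_disk[OF G]] G by simp
qed

text \<open>An equality of graphs and not only an isomorphism: disks keep the names of vertices, the
  balls up to \<open>j + 1\<close> agree, and every label visible at radius \<open>j\<close>
  survives at radius \<open>r\<close>.\<close>

lemma disk_disk_graph:
  assumes G: "pointed_graph G" and "j \<le> r"
  shows "disk_graph j (disk_graph r G) = disk_graph j G"
proof -
  have B: "ball_verts (disk_graph r G) j = ball_verts G j" "ball_verts (disk_graph r G) (j + 1) = ball_verts G (j + 1)"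
    using assms by (auto intro!: ball_disk_graph[OF G])
  have "ball_verts G j \<subseteq> ball_verts G r" "ball_verts G (j + 1) \<subseteq> ball_verts G (r + 1)"
    using assms by (auto intro!: ball_mono del: subsetI)
  then show ?thesis
    unfolding disk_graph_def[of j] B
    by (auto simp: disk_graph_def restrict_map_def fun_eq_iff)
qed

lemma disk_eq_mono:
  assumes "pointed_graph G" "pointed_graph H" "j \<le> r"
    and "disk r (iso_class G) = disk r (iso_class H)"
  shows "disk j (iso_class G) = disk j (iso_class H)"
proof -
  have "iso_class (disk_graph r G) = iso_class (disk_graph r H)"
    using assms by (simp add: disk_iso_class)
  then have "disk j (iso_class (disk_graph r G)) = disk j (iso_class (disk_graph r H))" by simp
  then show ?thesis
    using assms by (simp add: disk_iso_class pointed_graph_disk disk_disk_graph)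
qed

lemma disk_eqD:
  assumes "pointed_graph G" "pointed_graph H" "disk r (iso_class G) = disk r (iso_class H)"
  obtains f where "pgraph_iso f (disk_graph r G) (disk_graph r H)"
  using assms iso_class_eqD[of "disk_graph r G" "disk_graph r H"]
  by (auto simp: disk_iso_class pointed_graph_disk)

text \<open>A word of the disk that leads to \<open>v\<close> in \<open>G\<close> cannot lead
  elsewhere in the disk, by determinism. So the trace of a vertex, as used in \<open>in_disk\<close>
  and \<open>graph_R\<close>, is a genuine vertex of the disk.\<close>

lemma paths_to_disk:
  assumes G: "pointed_graph G" and v: "v \<in> ball_verts G (r + 1)"
  shows "paths_to G v \<inter> paths (disk r (iso_class G)) = paths_to (disk_graph r G) v"
proof -
  have p: "ptr (disk_graph r G) = ptr G" by (simp add: disk_graph_def)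
  show ?thesis
  proof (intro equalityI subsetI)
    fix w assume "w \<in> paths_to G v \<inter> paths (disk r (iso_class G))"
    then obtain u where w: "walk G w (ptr G) v" "walk (disk_graph r G) w (ptr G) u"
      by (auto simp: paths_to_def disk_iso_class[OF G] paths_iso_class[OF pointed_graph_disk[OF G]] p)
    moreover from this have "u = v" using disk_walk_imp[OF G] walk_det[OF G] by blast
    ultimately show "w \<in> paths_to (disk_graph r G) v" by (simp add: paths_to_def p)
  next
    fix w assume "w \<in> paths_to (disk_graph r G) v"
    then show "w \<in> paths_to G v \<inter> paths (disk r (iso_class G))"
      using disk_walk_imp[OF G]
      by (auto simp: paths_to_def disk_iso_class[OF G] paths_iso_class[OF pointed_graph_disk[OF G]] p)
  qed
qed

lemma in_disk_iff:
  assumes G: "pointed_graph G" and v: "v \<in> verts G"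
  shows "in_disk r (iso_class G) (paths_to G v) \<longleftrightarrow> v \<in> ball_verts G (r + 1)"
proof
  assume "v \<in> ball_verts G (r + 1)"
  then show "in_disk r (iso_class G) (paths_to G v)"
    using paths_to_nonempty[OF pointed_graph_disk[OF G, of r], of v]
    by (simp add: in_disk_def paths_to_disk[OF G]) (simp add: disk_graph_def)
next
  assume "in_disk r (iso_class G) (paths_to G v)"
  then obtain w u where w: "walk G w (ptr G) v" "walk (disk_graph r G) w (ptr (disk_graph r G)) u"
    by (auto simp: in_disk_def paths_to_def disk_iso_class[OF G] paths_iso_class[OF pointed_graph_disk[OF G]])
  have "walk G w (ptr G) u" using disk_walk_imp[OF G w(2)] by (simp add: disk_graph_def)
  then have "u = v" using walk_det[OF G] w(1) by blast
  then show "v \<in> ball_verts G (r + 1)"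
    using walk_verts[OF pointed_graph_disk[OF G] w(2)] by (simp add: disk_graph_def)
qed

section \<open>Reading the vertex map at different radii\<close>

definition represented :: "('s, 'd, 'p) pgm \<Rightarrow> bool" where
  "represented X \<longleftrightarrow> (\<exists>G :: (nat, 's, 'd, 'p) pgraph. pointed_graph G \<and> X = iso_class G)"

lemma represented_iso_class: "pointed_graph G \<Longrightarrow> represented (iso_class G)"
  by (metis represented_def nat_representative)

text \<open>One word inside the smaller disk identifies its vertex in the larger disk. The trace on
  the larger disk is thus recovered from the smaller trace and the larger disk alone.\<close>

lemma vtx_disk:
  assumes X: "represented X" and v: "v \<in> V X" and w: "w \<in> v \<inter> paths (disk n X)" and n: "n \<le> n'"
  shows "vtx (disk n' X) w = v \<inter> paths (disk n' X)"
proof -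
  obtain G :: "(nat, _, _, _) pgraph" where G: "pointed_graph G" "X = iso_class G" using X by (auto simp: represented_def)
  obtain x where x: "x \<in> verts G" "v = paths_to G x" using v G by (auto simp: V_iso_class)
  have b: "x \<in> ball_verts G (n + 1)"
    using w in_disk_iff[OF G(1) x(1)] x(2) G(2) by (auto simp: in_disk_def)
  have "w \<in> paths_to (disk_graph n G) x"
    using w paths_to_disk[OF G(1) b] x(2) G(2) by simp
  moreover have "ptr (disk_graph k G) = ptr G" for k by (simp add: disk_graph_def)
  ultimately have "walk (disk_graph n (disk_graph n' G)) w (ptr (disk_graph n' G)) x"
    by (simp add: paths_to_def disk_disk_graph[OF G(1) n])
  then have "walk (disk_graph n' G) w (ptr (disk_graph n' G)) x"
    by (rule disk_walk_imp[OF pointed_graph_disk[OF G(1)]])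
  then have "vtx (disk n' X) w = paths_to (disk_graph n' G) x"
    by (simp add: G(2) disk_iso_class[OF G(1)] vtx_iso_class[OF pointed_graph_disk[OF G(1)]])
  moreover have "x \<in> ball_verts G (n' + 1)" using b ball_mono[of "n + 1" "n' + 1" G] n by auto
  ultimately show ?thesis using paths_to_disk[OF G(1)] x(2) G(2) by simp
qed

lemma in_disk_mono:
  assumes "represented X" "v \<in> V X" "in_disk n X v" "n \<le> n'"
  shows "in_disk n' X v"
proof -
  obtain G :: "(nat, _, _, _) pgraph" where G: "pointed_graph G" "X = iso_class G"
    using assms(1) by (auto simp: represented_def)
  obtain x where "x \<in> verts G" "v = paths_to G x" using assms(2) G by (auto simp: V_iso_class)
  then show ?thesis
    using assms(3) in_disk_iff[OF G(1)] G(2) ball_mono[of "n + 1" "n' + 1" G] assms(4) by auto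
qed

text \<open>The function applied on the right depends on \<open>disk n' X\<close> only. Hence two
  points with the same disk of radius \<open>n'\<close> and the same \<open>graph_R\<close> at
  radius \<open>n\<close> also agree at radius \<open>n'\<close>; this allows a radius of continuity
  to be enlarged.\<close>

lemma graph_R_mono:
  assumes X: "represented X" and d: "\<forall>v\<in>dom_R F R m X. in_disk n X v" and n: "n \<le> n'"
  shows "graph_R F R n' m X = (\<lambda>(p, q). (\<Union>w\<in>p. vtx (disk n' X) w, q)) ` graph_R F R n m X"
proof -
  have "(\<Union>w\<in>v \<inter> paths (disk n X). vtx (disk n' X) w) = v \<inter> paths (disk n' X)" if "v \<in> dom_R F R m X" for v
  proof -
    have "v \<in> V X" using that by (simp add: dom_R_def)
    then have "vtx (disk n' X) w = v \<inter> paths (disk n' X)" if "w \<in> v \<inter> paths (disk n X)" for w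
      using vtx_disk[OF X _ that n] by simp
    moreover have "v \<inter> paths (disk n X) \<noteq> {}" using d \<open>v \<in> dom_R F R m X\<close> by (simp add: in_disk_def)
    ultimately show ?thesis by auto
  qed
  then show ?thesis unfolding graph_R_def image_image by (intro image_cong) auto
qed

text \<open>The right-hand side depends only on the disks of radii \<open>m\<close> and
  \<open>n\<close>, which is the continuity of the identity dynamics in the form required by
  \<open>continuous_dyn\<close>.\<close>

lemma graph_R_identity:
  assumes X: "represented X" and n: "m \<le> n"
  shows "graph_R (\<lambda>X. X) (\<lambda>X v. v) n m X = (\<lambda>q. (\<Union>w\<in>q. vtx (disk n X) w, q)) ` V (disk m X)"
proof -
  obtain G :: "(nat, _, _, _) pgraph" where G: "pointed_graph G" "X = iso_class G" using X by (auto simp: represented_def)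
  have "(\<lambda>v. v \<inter> paths (disk m X)) ` dom_R (\<lambda>X. X) (\<lambda>X v. v) m X = V (disk m X)"
  proof -
    have "dom_R (\<lambda>X. X) (\<lambda>X v. v) m X = paths_to G ` ball_verts G (m + 1)"
      using ball_verts_subset[OF G(1), of "m + 1"] in_disk_iff[OF G(1)]
      by (auto simp: dom_R_def G(2) V_iso_class[OF G(1)])
    moreover have "V (disk m X) = paths_to (disk_graph m G) ` ball_verts G (m + 1)"
      by (simp add: G(2) disk_iso_class[OF G(1)] V_iso_class[OF pointed_graph_disk[OF G(1)]])
        (simp add: disk_graph_def)
    ultimately show ?thesis using paths_to_disk[OF G(1)] G(2) by (simp add: image_image)
  qed
  moreover have "graph_R (\<lambda>X. X) (\<lambda>X v. v) m m X = (\<lambda>q. (q, q)) ` (\<lambda>v. v \<inter> paths (disk m X)) ` dom_R (\<lambda>X. X) (\<lambda>X v. v) m X"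
    by (simp add: graph_R_def image_image)
  moreover have "\<forall>v\<in>dom_R (\<lambda>X. X) (\<lambda>X v. v) m X. in_disk m X v" by (simp add: dom_R_def)
  ultimately show ?thesis using graph_R_mono[OF X _ n] by (simp add: image_image)
qed

section \<open>Attaching invisible matter\<close>

definition child_port :: "bool \<Rightarrow> 'p mport" where
  "child_port d = (if d then Port_r else Port_l)"

definition tree_path :: "bool list \<Rightarrow> 'p mport path" where
  "tree_path s = map (\<lambda>d. (child_port d, Port_m)) s"

lemma child_port_simps [simp]:
  "child_port d = child_port d' \<longleftrightarrow> d = d'"
  "child_port d \<noteq> Port_m" "Port_m \<noteq> child_port d"
  "child_port d \<noteq> Port q" "Port q \<noteq> child_port d"
  by (auto simp: child_port_def)

lemma tree_path_simps [simp]: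
  "tree_path [] = []" "tree_path (d # s) = (child_port d, Port_m) # tree_path s"
  "tree_path (s @ t) = tree_path s @ tree_path t" "length (tree_path s) = length s"
  by (simp_all add: tree_path_def)

lemma tree_words_eq: "tree_words = range tree_path"
proof -
  have eq: "{(Port_l, Port_m), (Port_r, Port_m)} = range (\<lambda>d. (child_port d, Port_m))"
    by (auto simp: child_port_def UNIV_bool)
  show ?thesis unfolding tree_words_def eq lists_image lists_UNIV tree_path_def[abs_def] by simp
qed

lemma tree_edges_eq: "tree_edges = (\<Union>s d. {{(s, child_port d), (s @ [d], Port_m)}})"
  by (auto simp: tree_edges_def child_port_def UNIV_bool)

lemma attach_graph_simps [simp]:
  "ptr (attach_graph G) = Inl (ptr G)"
  "Inl v \<in> verts (attach_graph G) \<longleftrightarrow> v \<in> verts G"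
  "Inr (v, s) \<in> verts (attach_graph G) \<longleftrightarrow> v \<in> verts G"
  "vlab (attach_graph G) (Inl v) = vlab G v"
  "vlab (attach_graph G) (Inr (v, s)) = (if v \<in> verts G then Some Label_m else None)"
  by (auto simp: attach_graph_def)

lemma attach_edge_iff:
  "e \<in> edges (attach_graph G) \<longleftrightarrow>
     (\<exists>e0\<in>edges G. e = map_prod Inl id ` e0) \<or>
     (\<exists>v\<in>verts G. \<exists>s d. e = {(Inr (v, s), child_port d), (Inr (v, s @ [d]), Port_m)}) \<or>
     (\<exists>v\<in>verts G. e = {(Inl v, Port_m), (Inr (v, []), Port_m)})"
proof -
  have "edges (attach_graph G) = (\<lambda>e. map_prod Inl id ` e) ` edges G \<union>
    (\<Union>v\<in>verts G. \<Union>s d. {{(Inr (v, s), child_port d), (Inr (v, s @ [d]), Port_m)}}) \<union>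
    (\<Union>v\<in>verts G. {{(Inl v, Port_m), (Inr (v, []), Port_m)}})"
    by (simp add: attach_graph_def tree_edges_eq image_UN)
  then show ?thesis by auto
qed

lemma attach_edgeI:
  "e \<in> edges G \<Longrightarrow> map_prod Inl id ` e \<in> edges (attach_graph G)"
  "v \<in> verts G \<Longrightarrow> {(Inr (v, s), child_port d), (Inr (v, s @ [d]), Port_m)} \<in> edges (attach_graph G)"
  "v \<in> verts G \<Longrightarrow> {(Inl v, Port_m), (Inr (v, []), Port_m)} \<in> edges (attach_graph G)"
  unfolding attach_edge_iff by blast+

lemma attach_edge_InlE:
  assumes "e \<in> edges (attach_graph G)" "(Inl v, a) \<in> e"
  obtains (root) "v \<in> verts G" "a = Port_m" "e = {(Inl v, Port_m), (Inr (v, []), Port_m)}"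
    | (base) e0 where "e0 \<in> edges G" "(v, a) \<in> e0" "e = map_prod Inl id ` e0"
  using assms unfolding attach_edge_iff by auto

lemma attach_edge_InrE:
  assumes "e \<in> edges (attach_graph G)" "(Inr (v, s), a) \<in> e"
  obtains (child) d where "v \<in> verts G" "a = child_port d"
      "e = {(Inr (v, s), child_port d), (Inr (v, s @ [d]), Port_m)}"
    | (parent) t d where "v \<in> verts G" "a = Port_m" "s = t @ [d]"
      "e = {(Inr (v, t), child_port d), (Inr (v, t @ [d]), Port_m)}"
    | (root) "v \<in> verts G" "a = Port_m" "s = []" "e = {(Inl v, Port_m), (Inr (v, []), Port_m)}"
  using assms unfolding attach_edge_iff by auto

definition base_graph :: "'s set \<Rightarrow> 'd set \<Rightarrow> 'p set \<Rightarrow> ('v, 's mlabel, 'd, 'p mport) pgraph \<Rightarrow> bool"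
  where "base_graph \<Sigma> \<Delta> \<pi> G \<longleftrightarrow> pointed_graph G \<and> over_alphabets (Label ` \<Sigma>) \<Delta> (Port ` \<pi>) G"

lemma base_graph_port:
  assumes "base_graph \<Sigma> \<Delta> \<pi> G" "e \<in> edges G" "(v, a) \<in> e"
  shows "a \<in> Port ` \<pi>"
proof -
  have "snd ` e \<subseteq> Port ` \<pi>" using assms(1,2) by (simp add: base_graph_def over_alphabets_def)
  then show ?thesis using assms(3) by force
qed

lemma base_graph_ptr: "base_graph \<Sigma> \<Delta> \<pi> G \<Longrightarrow> v \<in> verts G \<Longrightarrow> base_graph \<Sigma> \<Delta> \<pi> (G\<lparr>ptr := v\<rparr>)"
  by (simp add: base_graph_def pointed_graph_ptr over_alphabets_def)

lemma base_graph_label: "base_graph \<Sigma> \<Delta> \<pi> G \<Longrightarrow> vlab G v \<noteq> Some Label_m"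
  by (auto simp: base_graph_def over_alphabets_def ran_def)

lemma attach_graph_ptr: "attach_graph (G\<lparr>ptr := v\<rparr>) = (attach_graph G)\<lparr>ptr := Inl v\<rparr>"
  by (simp add: attach_graph_def cong del: sum.case_cong_weak if_weak_cong)

lemma elab_attach_base:
  fixes G :: "('v, 's mlabel, 'd, 'p mport) pgraph"
  assumes "e \<in> edges G"
  shows "elab (attach_graph G) (map_prod Inl id ` e) = elab G e"
proof -
  have "map_prod projl id ` map_prod (Inl :: 'v \<Rightarrow> 'v + 'v \<times> bool list) id ` e = e" by (force simp: image_image)
  then show ?thesis using assms by (simp add: attach_graph_def)
qed

lemma elab_attach_tree: "(Inr x, a) \<in> e \<Longrightarrow> elab (attach_graph G) e = None"
  by (auto simp: attach_graph_def)

lemma elab_attach_tree_doubleton [simp]: "elab (attach_graph G) {p, (Inr x, a)} = None"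
  by (rule elab_attach_tree[of x a]) simp

lemma walk_attach_base:
  assumes "walk G w u v"
  shows "walk (attach_graph G) w (Inl u) (Inl v)"
  using assms
proof (induction w arbitrary: u)
  case (Cons c w)
  then obtain x where x: "{(u, fst c), (x, snd c)} \<in> edges G" "walk G w x v" by auto
  have "map_prod Inl id ` {(u, fst c), (x, snd c)} \<in> edges (attach_graph G)"
    by (rule attach_edgeI(1)[OF x(1)])
  then show ?case using Cons.IH[OF x(2)] by auto
qed simp

lemma walk_attach_tree:
  assumes "v \<in> verts G"
  shows "walk (attach_graph G) (tree_path t) (Inr (v, s)) (Inr (v, s @ t))"
proof (induction t arbitrary: s)
  case (Cons d t)
  have "{(Inr (v, s), child_port d), (Inr (v, s @ [d]), Port_m)} \<in> edges (attach_graph G)"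
    by (rule attach_edgeI(2)[OF assms])
  then show ?case using Cons.IH[of "s @ [d]"] by auto
qed (simp add: assms)

lemma walk_attach_root:
  assumes "v \<in> verts G"
  shows "walk (attach_graph G) ((Port_m, Port_m) # tree_path s) (Inl v) (Inr (v, s))"
proof -
  have "{(Inl v, Port_m), (Inr (v, []), Port_m)} \<in> edges (attach_graph G)"
    by (rule attach_edgeI(3)[OF assms])
  then show ?thesis using walk_attach_tree[OF assms, of s "[]"] by auto
qed

text \<open>The delicate condition is that no port is used twice. Edges of \<open>G\<close> only use
  ports of the form \<open>Port q\<close>, which leaves \<open>Port_m\<close> free for the tree at
  every vertex of \<open>G\<close>; a tree node uses \<open>Port_m\<close> for its upward edge
  only.\<close>

lemma pointed_graph_attach:
  assumes B: "base_graph \<Sigma> \<Delta> \<pi> G"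
  shows "pointed_graph (attach_graph G)"
proof -
  let ?A = "attach_graph G"
  have G: "pointed_graph G" using B by (simp add: base_graph_def)
  have wf: "card e = 2 \<and> fst ` e \<subseteq> verts ?A" if "e \<in> edges ?A" for e
    using that unfolding attach_edge_iff
  proof (elim disjE bexE exE)
    fix e0 assume e0: "e0 \<in> edges G" "e = map_prod Inl id ` e0"
    obtain u a v b where "e0 = {(u, a), (v, b)}" "(u, a) \<noteq> (v, b)" "u \<in> verts G" "v \<in> verts G"
      by (rule edgeE[OF G e0(1)])
    then show ?thesis using e0(2) by (auto simp: card_2_iff)
  qed (auto simp: card_2_iff)
  moreover have "e = e'" if e: "e \<in> edges ?A" "e' \<in> edges ?A" "e \<inter> e' \<noteq> {}" for e e'
  proof -
    obtain x a where x: "(x, a) \<in> e" "(x, a) \<in> e'" using e(3) by auto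
    show ?thesis
    proof (cases x)
      case (Inl v)
      note x = x[unfolded Inl]
      show ?thesis
      proof (cases rule: attach_edge_InlE[OF e(1) x(1)])
        case 1
        show ?thesis
          by (cases rule: attach_edge_InlE[OF e(2) x(2)]) (use 1 base_graph_port[OF B] in auto)
      next
        case (2 e0)
        show ?thesis
        proof (cases rule: attach_edge_InlE[OF e(2) x(2)])
          case 1
          then show ?thesis using 2 base_graph_port[OF B] by auto
        next
          case (2 e1)
          then have "e0 = e1" using edge_eqI[OF G, of e0 e1 "(v, a)"] \<open>e0 \<in> edges G\<close> \<open>(v, a) \<in> e0\<close> by simp
          then show ?thesis using 2 \<open>e = map_prod Inl id ` e0\<close> by simp
        qed
      qed
    next
      case (Inr y)
      obtain v s where "y = (v, s)" by fastforce
      note x = x[unfolded Inr this]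
      show ?thesis
        by (cases rule: attach_edge_InrE[OF e(1) x(1)]) (use attach_edge_InrE[OF e(2) x(2)] in force)+
    qed
  qed
  moreover have "\<forall>x\<in>verts ?A. \<forall>y\<in>verts ?A. \<exists>w. walk ?A w x y"
  proof (rule connectedI)
    fix x assume x: "x \<in> verts ?A"
    have base: "\<exists>w. walk ?A w (Inl (ptr G)) (Inl v)" if "v \<in> verts G" for v
      using connectedE[OF G ptr_in_verts[OF G] that] walk_attach_base by metis
    show "\<exists>w. walk ?A w (Inl (ptr G)) x"
    proof (cases x)
      case (Inr y)
      then obtain v s where y: "x = Inr (v, s)" "v \<in> verts G" using x by (cases y) auto
      then show ?thesis using base[OF y(2)] walk_attach_root[OF y(2)] walk_trans by metis
    qed (use base x in auto)
  qed (use wf in blast)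
  moreover have "countable (verts ?A)" using G by (simp add: attach_graph_def pointed_graph_def)
  moreover have "x \<in> verts ?A" if "vlab ?A x = Some s" for x s
  proof -
    have "dom (vlab G) \<subseteq> verts G" using G by (simp add: pointed_graph_def)
    then show ?thesis using that by (cases x) (auto split: if_splits)
  qed
  then have "dom (vlab ?A) \<subseteq> verts ?A" by blast
  moreover have "dom (elab ?A) \<subseteq> edges ?A"
    by (auto simp: attach_graph_def split: if_splits)
  moreover have "ptr ?A \<in> verts ?A" using ptr_in_verts[OF G] by simp
  ultimately show ?thesis unfolding pointed_graph_def by blast
qed

lemma over_alphabets_attach:
  assumes "base_graph \<Sigma> \<Delta> \<pi> G"
  shows "over_alphabets (Label ` \<Sigma> \<union> {Label_m}) \<Delta> (Port ` \<pi> \<union> {Port_m, Port_l, Port_r}) (attach_graph G)"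
proof -
  have G: "ran (vlab G) \<subseteq> Label ` \<Sigma>" "ran (elab G) \<subseteq> \<Delta>"
    using assms by (auto simp: base_graph_def over_alphabets_def)
  have "s \<in> Label ` \<Sigma> \<union> {Label_m}" if "vlab (attach_graph G) x = Some s" for x s
    using that G(1) by (cases x) (auto simp: attach_graph_def ran_def split: if_splits)
  then have "ran (vlab (attach_graph G)) \<subseteq> Label ` \<Sigma> \<union> {Label_m}" by (auto simp: ran_def)
  moreover have "ran (elab (attach_graph G)) \<subseteq> \<Delta>"
    using G(2) by (auto simp: attach_graph_def ran_def split: if_splits)
  moreover have "snd ` e \<subseteq> Port ` \<pi> \<union> {Port_m, Port_l, Port_r}" if "e \<in> edges (attach_graph G)" for e
    using that[unfolded attach_edge_iff]
  proof (elim disjE bexE exE)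
    fix v s d assume "e = {(Inr (v, s), child_port d), (Inr (v, s @ [d]), Port_m)}"
    then show ?thesis by (cases d) (simp_all add: child_port_def)
  qed (use base_graph_port[OF assms] in auto)
  ultimately show ?thesis by (simp add: over_alphabets_def)
qed

lemma iso_attach:
  fixes G :: "('v, 's mlabel, 'd, 'p mport) pgraph" and H :: "('w, 's mlabel, 'd, 'p mport) pgraph"
  assumes f: "pgraph_iso f G H"
  shows "pgraph_iso (map_sum f (map_prod f id)) (attach_graph G) (attach_graph H)"
proof -
  let ?f = "map_sum f (map_prod f id)"
  have vH: "verts H = f ` verts G" and eH: "edges H = (\<lambda>e. map_prod f id ` e) ` edges G"
    using f by (auto simp: pgraph_iso_def bij_betw_def)
  have map_base: "map_prod ?f id ` map_prod Inl id ` e = map_prod Inl id ` map_prod f id ` e"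
    for e :: "(_ \<times> 'x) set"
    by (force simp: image_image)
  have "e \<in> edges (attach_graph H) \<longleftrightarrow> e \<in> (\<lambda>e. map_prod ?f id ` e) ` edges (attach_graph G)" for e
  proof
    assume "e \<in> edges (attach_graph H)"
    then consider (base) e0 where "e0 \<in> edges G" "e = map_prod Inl id ` map_prod f id ` e0"
      | (tree) v s d where "v \<in> verts G" "e = {(Inr (f v, s), child_port d), (Inr (f v, s @ [d]), Port_m)}"
      | (root) v where "v \<in> verts G" "e = {(Inl (f v), Port_m), (Inr (f v, []), Port_m)}"
      unfolding attach_edge_iff[of _ H] vH eH by blast
    then show "e \<in> (\<lambda>e. map_prod ?f id ` e) ` edges (attach_graph G)"
    proof cases
      case base
      then show ?thesis using attach_edgeI(1)[OF base(1)] unfolding map_base[symmetric] by blast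
    next
      case tree
      then have "e = map_prod ?f id ` {(Inr (v, s), child_port d), (Inr (v, s @ [d]), Port_m)}"
        by simp
      then show ?thesis using attach_edgeI(2)[OF tree(1)] by blast
    next
      case root
      then have "e = map_prod ?f id ` {(Inl v, Port_m), (Inr (v, []), Port_m)}" by simp
      then show ?thesis using attach_edgeI(3)[OF root(1)] by blast
    qed
  next
    assume "e \<in> (\<lambda>e. map_prod ?f id ` e) ` edges (attach_graph G)"
    then obtain e' where e': "e' \<in> edges (attach_graph G)" "e = map_prod ?f id ` e'" by blast
    from e'(1)[unfolded attach_edge_iff] show "e \<in> edges (attach_graph H)"
    proof (elim disjE bexE exE)
      fix e0 assume e0: "e0 \<in> edges G" "e' = map_prod Inl id ` e0"
      show ?thesis
        using attach_edgeI(1)[OF iso_edge_image[OF f e0(1)]] by (simp add: e' e0 map_base)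
    next
      fix v s d assume v: "v \<in> verts G" "e' = {(Inr (v, s), child_port d), (Inr (v, s @ [d]), Port_m)}"
      show ?thesis using attach_edgeI(2)[OF iso_verts[OF f v(1)]] by (simp add: e' v)
    next
      fix v assume v: "v \<in> verts G" "e' = {(Inl v, Port_m), (Inr (v, []), Port_m)}"
      show ?thesis using attach_edgeI(3)[OF iso_verts[OF f v(1)]] by (simp add: e' v)
    qed
  qed
  then have "edges (attach_graph H) = (\<lambda>e. map_prod ?f id ` e) ` edges (attach_graph G)" by blast
  moreover have "bij_betw ?f (verts (attach_graph G)) (verts (attach_graph H))"
  proof -
    have "inj_on ?f (verts (attach_graph G))"
    proof (rule inj_onI)
      fix x y assume xy: "x \<in> verts (attach_graph G)" "y \<in> verts (attach_graph G)" "?f x = ?f y"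
      show "x = y"
        by (cases x; cases y) (use xy iso_inj[OF f] in \<open>fastforce split: prod.splits\<close>)+
    qed
    moreover have "?f ` verts (attach_graph G) = verts (attach_graph H)"
    proof -
      have "map_prod f id ` (verts G \<times> (UNIV :: bool list set)) = verts H \<times> UNIV"
        by (simp add: map_prod_surj_on vH)
      then have "(\<lambda>x. Inr (map_prod f id x) :: 'w + 'w \<times> bool list) ` (verts G \<times> UNIV) = Inr ` (verts H \<times> UNIV)"
        by (metis image_image)
      then show ?thesis
        by (simp add: attach_graph_def image_Un image_image vH)
    qed
    ultimately show ?thesis by (simp add: bij_betw_def)
  qed
  moreover have "vlab (attach_graph H) (?f x) = vlab (attach_graph G) x" if "x \<in> verts (attach_graph G)" for x
  proof (cases x)
    case (Inl v)
    then show ?thesis using that f by (simp add: pgraph_iso_def)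
  next
    case (Inr y)
    then show ?thesis using that by (cases y) (simp add: vH)
  qed
  moreover have "elab (attach_graph H) (map_prod ?f id ` e) = elab (attach_graph G) e"
    if "e \<in> edges (attach_graph G)" for e
    using that[unfolded attach_edge_iff]
  proof (elim disjE bexE exE)
    fix e0 assume "e0 \<in> edges G" "e = map_prod Inl id ` e0"
    then show ?thesis using f by (simp add: map_base elab_attach_base eH) (simp add: pgraph_iso_def)
  qed simp_all
  ultimately show ?thesis using f by (simp add: pgraph_iso_def)
qed

lemma attach_iso_class:
  assumes B: "base_graph \<Sigma> \<Delta> \<pi> G"
  shows "attach (iso_class G) = iso_class (attach_graph G)"
  unfolding attach_def
proof (rule UN_iso_class)
  show "pointed_graph G" using B by (simp add: base_graph_def)
qed (rule iso_class_eqI[OF iso_attach pointed_graph_attach[OF B], symmetric])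

lemma Y_set_iff:
  "Y \<in> Y_set \<Sigma> \<Delta> \<pi> \<longleftrightarrow>
     (\<exists>(B :: (nat, _, _, _) pgraph) x. base_graph \<Sigma> \<Delta> \<pi> B \<and> x \<in> verts (attach_graph B) \<and>
        Y = iso_class ((attach_graph B)\<lparr>ptr := x\<rparr>))"
proof
  assume "Y \<in> Y_set \<Sigma> \<Delta> \<pi>"
  then obtain X u where X: "X \<in> X_base \<Sigma> \<Delta> \<pi>" "u \<in> V (attach X)" "Y = shift (attach X) u"
    by (auto simp: Y_set_def)
  then obtain B :: "(nat, _, _, _) pgraph" where B: "base_graph \<Sigma> \<Delta> \<pi> B" "X = iso_class B"
    by (auto simp: pgms_def base_graph_def)
  note A = pointed_graph_attach[OF B(1)]
  obtain x where "x \<in> verts (attach_graph B)" "u = paths_to (attach_graph B) x"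
    using X(2) unfolding B(2) attach_iso_class[OF B(1)] V_iso_class[OF A] by blast
  then show "\<exists>(B :: (nat, _, _, _) pgraph) x. base_graph \<Sigma> \<Delta> \<pi> B \<and> x \<in> verts (attach_graph B) \<and>
        Y = iso_class ((attach_graph B)\<lparr>ptr := x\<rparr>)"
    using X(3) B shift_iso_class[OF A] by (auto simp: attach_iso_class[OF B(1)])
next
  assume "\<exists>(B :: (nat, _, _, _) pgraph) x. base_graph \<Sigma> \<Delta> \<pi> B \<and> x \<in> verts (attach_graph B) \<and>
        Y = iso_class ((attach_graph B)\<lparr>ptr := x\<rparr>)"
  then obtain B :: "(nat, _, _, _) pgraph" and x
    where B: "base_graph \<Sigma> \<Delta> \<pi> B" and x: "x \<in> verts (attach_graph B)" "Y = iso_class ((attach_graph B)\<lparr>ptr := x\<rparr>)"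
    by blast
  note A = pointed_graph_attach[OF B]
  have "iso_class B \<in> X_base \<Sigma> \<Delta> \<pi>" using B by (auto simp: pgms_def base_graph_def)
  moreover have "Y = shift (attach (iso_class B)) (paths_to (attach_graph B) x)"
    using x shift_iso_class[OF A] by (simp add: attach_iso_class[OF B])
  moreover have "paths_to (attach_graph B) x \<in> V (attach (iso_class B))"
    using x by (simp add: attach_iso_class[OF B] V_iso_class[OF A])
  ultimately show "Y \<in> Y_set \<Sigma> \<Delta> \<pi>" unfolding Y_set_def by blast
qed

lemma Y_setE:
  assumes "Y \<in> Y_set \<Sigma> \<Delta> \<pi>"
  obtains B :: "(nat, 's mlabel, 'd, 'p mport) pgraph" and x
  where "base_graph \<Sigma> \<Delta> \<pi> B" "x \<in> verts (attach_graph B)" "pointed_graph ((attach_graph B)\<lparr>ptr := x\<rparr>)"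
    "Y = iso_class ((attach_graph B)\<lparr>ptr := x\<rparr>)"
  using assms pointed_graph_ptr[OF pointed_graph_attach] unfolding Y_set_iff by blast

text \<open>\<open>matter_shift\<close> only enters the tree attached to the pointer. Re-pointing
  the base graph at \<open>b\<close> makes the quiescence condition available in the tree of every
  base vertex.\<close>

lemma matter_shift_eq:
  assumes B: "base_graph \<Sigma> \<Delta> \<pi> B" and b: "b \<in> verts B"
  shows "matter_shift (iso_class (B\<lparr>ptr := b\<rparr>)) (tree_path s) = iso_class ((attach_graph B)\<lparr>ptr := Inr (b, s)\<rparr>)"
proof -
  let ?A = "(attach_graph B)\<lparr>ptr := Inl b\<rparr>"
  have A: "pointed_graph ?A" using pointed_graph_ptr[OF pointed_graph_attach[OF B]] b by simp
  have "vtx (iso_class ?A) ((Port_m, Port_m) # tree_path s) = paths_to ?A (Inr (b, s))"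
  proof (rule vtx_iso_class[OF A])
    show "walk ?A ((Port_m, Port_m) # tree_path s) (ptr ?A) (Inr (b, s))"
      using walk_attach_root[OF b] unfolding walk_ptr by simp
  qed
  then show ?thesis
    using shift_iso_class[OF A, of "Inr (b, s)"] b
    by (simp add: matter_shift_def attach_iso_class[OF base_graph_ptr[OF B b]] attach_graph_ptr)
qed

section \<open>Recognising invisible matter locally\<close>

definition is_matter :: "('v, 's mlabel, 'd, 'p mport) pgraph \<Rightarrow> 'v \<Rightarrow> bool" where
  "is_matter G v \<longleftrightarrow> vlab G v = Some Label_m"

text \<open>Involves only the edges at \<open>v\<close> and the labels of its neighbours, so it is
  visible in a disk and passes to limits. A matter vertex has two children, an upward edge to a
  parent or to a base vertex, no further ports in use and no edge labels. Any other vertex carries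
  the root of a tree at \<open>Port_m\<close> and uses no child port.\<close>

definition matter_at :: "('v, 's mlabel, 'd, 'p mport) pgraph \<Rightarrow> 'v \<Rightarrow> bool" where
  "matter_at G v \<longleftrightarrow>
     (if is_matter G v then
        (\<forall>d. \<exists>x. is_matter G x \<and> {(v, child_port d), (x, Port_m)} \<in> edges G) \<and>
        ((\<exists>x d. is_matter G x \<and> {(v, Port_m), (x, child_port d)} \<in> edges G) \<or>
         (\<exists>x. \<not> is_matter G x \<and> {(v, Port_m), (x, Port_m)} \<in> edges G)) \<and>
        (\<forall>x a b. {(v, a), (x, b)} \<in> edges G \<longrightarrow>
           (a = Port_m \<or> (\<exists>d. a = child_port d)) \<and> elab G {(v, a), (x, b)} = None)
      else
        (\<exists>x. is_matter G x \<and> {(v, Port_m), (x, Port_m)} \<in> edges G) \<and>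
        (\<forall>x a b. {(v, a), (x, b)} \<in> edges G \<longrightarrow> (\<forall>d. a \<noteq> child_port d)))"

text \<open>Only the star around \<open>v\<close> is compared, so the lemma covers isomorphisms as
  well as the passage to a disk and back. The existential clauses of \<open>matter_at\<close>
  require \<open>fwd\<close> to respect the matter status of neighbours; the universal clauses
  mention ports and edge labels only, so \<open>bwd\<close> asks for no more.\<close>

lemma matter_at_transfer:
  assumes m: "matter_at G v"
    and v: "is_matter H (f v) \<longleftrightarrow> is_matter G v"
    and fwd: "\<And>x a b. {(v, a), (x, b)} \<in> edges G \<Longrightarrow>
      {(f v, a), (f x, b)} \<in> edges H \<and> (is_matter H (f x) \<longleftrightarrow> is_matter G x)"
    and bwd: "\<And>y a b. {(f v, a), (y, b)} \<in> edges H \<Longrightarrow>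
      \<exists>x. {(v, a), (x, b)} \<in> edges G \<and> elab H {(f v, a), (y, b)} = elab G {(v, a), (x, b)}"
  shows "matter_at H (f v)"
proof (cases "is_matter G v")
  case True
  note m = m[unfolded matter_at_def if_P[OF True]]
  have "\<exists>y. is_matter H y \<and> {(f v, child_port d), (y, Port_m)} \<in> edges H" for d
    using m fwd by metis
  moreover have "(\<exists>y d. is_matter H y \<and> {(f v, Port_m), (y, child_port d)} \<in> edges H) \<or>
         (\<exists>y. \<not> is_matter H y \<and> {(f v, Port_m), (y, Port_m)} \<in> edges H)"
    using m fwd by metis
  moreover have "(a = Port_m \<or> (\<exists>d. a = child_port d)) \<and> elab H {(f v, a), (y, b)} = None"
    if "{(f v, a), (y, b)} \<in> edges H" for y a b
    using bwd[OF that] m by metis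
  ultimately show ?thesis using True v by (simp add: matter_at_def)
next
  case False
  note m = m[unfolded matter_at_def if_not_P[OF False]]
  have "\<exists>y. is_matter H y \<and> {(f v, Port_m), (y, Port_m)} \<in> edges H" using m fwd by metis
  moreover have "a \<noteq> child_port d" if "{(f v, a), (y, b)} \<in> edges H" for y a b d
    using bwd[OF that] m by metis
  ultimately show ?thesis using False v by (simp add: matter_at_def)
qed

lemma iso_is_matter: "pgraph_iso f G H \<Longrightarrow> v \<in> verts G \<Longrightarrow> is_matter H (f v) \<longleftrightarrow> is_matter G v"
  by (simp add: pgraph_iso_def is_matter_def)

lemma matter_at_iso:
  assumes f: "pgraph_iso f G H" and G: "pointed_graph G" and H: "pointed_graph H"
    and v: "v \<in> verts G" and m: "matter_at G v"
  shows "matter_at H (f v)"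
  using m
proof (rule matter_at_transfer)
  show "is_matter H (f v) \<longleftrightarrow> is_matter G v" by (rule iso_is_matter[OF f v])
next
  fix x a b assume e: "{(v, a), (x, b)} \<in> edges G"
  have x: "x \<in> verts G" using edge_verts[OF G e, of x b] by simp
  then show "{(f v, a), (f x, b)} \<in> edges H \<and> (is_matter H (f x) \<longleftrightarrow> is_matter G x)"
    using e iso_edge[OF f G v x] iso_is_matter[OF f x] by simp
next
  fix y a b assume e: "{(f v, a), (y, b)} \<in> edges H"
  have "y \<in> verts H" using edge_verts[OF H e, of y b] by simp
  then obtain x where x: "x \<in> verts G" "y = f x" by (rule iso_surj[OF f])
  have e': "{(v, a), (x, b)} \<in> edges G" using e iso_edge[OF f G v x(1)] x(2) by simp
  have "elab H (map_prod f id ` {(v, a), (x, b)}) = elab G {(v, a), (x, b)}"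
    using f e' unfolding pgraph_iso_def by blast
  then show "\<exists>x. {(v, a), (x, b)} \<in> edges G \<and> elab H {(f v, a), (y, b)} = elab G {(v, a), (x, b)}"
    using e' x(2) by auto
qed

lemma is_matter_disk: "v \<in> ball_verts G r \<Longrightarrow> is_matter (disk_graph r G) v \<longleftrightarrow> is_matter G v"
  by (simp add: is_matter_def disk_graph_def)

text \<open>The neighbours of \<open>v\<close> lie at distance up to \<open>Suc r\<close>, and their
  labels are kept only by a disk of that radius.\<close>

lemma matter_at_disk:
  assumes G: "pointed_graph G" and v: "v \<in> ball_verts G r"
  shows "matter_at (disk_graph (Suc r) G) v \<longleftrightarrow> matter_at G v"
proof -
  let ?D = "disk_graph (Suc r) G"
  have ball: "v \<in> ball_verts G (Suc r)" using v ball_mono[of r "Suc r" G] by auto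
  have near: "x \<in> ball_verts G (Suc r)" if "{(v, a), (x, b)} \<in> edges G" for a x b
    by (rule ball_step[OF G v that])
  have sub: "ball_verts G (Suc r) \<subseteq> ball_verts G (Suc (Suc r))" by (rule ball_mono) simp
  have e: "{(v, a), (x, b)} \<in> edges ?D \<longleftrightarrow> {(v, a), (x, b)} \<in> edges G" for a x b
    using near[of a x b] ball sub by (auto simp: disk_graph_def)
  have l: "elab ?D {(v, a), (x, b)} = elab G {(v, a), (x, b)}" if "{(v, a), (x, b)} \<in> edges G" for a x b
    using near[OF that] ball by (simp add: disk_graph_def restrict_map_def)
  have m: "is_matter ?D x \<longleftrightarrow> is_matter G x" if "{(v, a), (x, b)} \<in> edges G" for a x b
    by (rule is_matter_disk[OF near[OF that]])
  note mv = is_matter_disk[OF ball]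
  show ?thesis
  proof
    assume "matter_at ?D v"
    then show "matter_at G v"
      by (rule matter_at_transfer[where f = "\<lambda>x. x"]) (use e l m mv in auto)
  next
    assume "matter_at G v"
    then show "matter_at ?D v"
      by (rule matter_at_transfer[where f = "\<lambda>x. x"]) (use e l m mv in auto)
  qed
qed

lemma matter_at_ptr [simp]: "matter_at (G\<lparr>ptr := x\<rparr>) v \<longleftrightarrow> matter_at G v"
  by (simp add: matter_at_def is_matter_def)

lemma is_matter_attach [simp]:
  "is_matter (attach_graph G) (Inl v) \<longleftrightarrow> is_matter G v"
  "is_matter (attach_graph G) (Inr (v, s)) \<longleftrightarrow> v \<in> verts G"
  by (simp_all add: is_matter_def)

lemma matter_at_attach:
  assumes B: "base_graph \<Sigma> \<Delta> \<pi> B" and x: "x \<in> verts (attach_graph B)"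
  shows "matter_at (attach_graph B) x"
proof (cases x)
  case (Inl v)
  then have v: "v \<in> verts B" using x by simp
  have m: "\<not> is_matter (attach_graph B) (Inl v)" using base_graph_label[OF B] by (simp add: is_matter_def)
  have "is_matter (attach_graph B) (Inr (v, [])) \<and> {(Inl v, Port_m), (Inr (v, []), Port_m)} \<in> edges (attach_graph B)"
    using v attach_edgeI(3)[OF v] by simp
  moreover have "a \<noteq> child_port d" if e: "{(Inl v, a), (y, b)} \<in> edges (attach_graph B)" for y a b d
  proof (rule attach_edge_InlE[OF e])
    fix e0 assume "e0 \<in> edges B" "(v, a) \<in> e0"
    then show ?thesis using base_graph_port[OF B, of e0 v a] by auto
  qed auto
  ultimately show ?thesis unfolding Inl matter_at_def if_not_P[OF m] by blast
next
  case (Inr y)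
  then obtain v s where y: "x = Inr (v, s)" by (cases y) auto
  then have v: "v \<in> verts B" using x by simp
  have m: "is_matter (attach_graph B) (Inr (v, s))" for s using v by simp
  have "is_matter (attach_graph B) (Inr (v, s @ [d])) \<and>
      {(Inr (v, s), child_port d), (Inr (v, s @ [d]), Port_m)} \<in> edges (attach_graph B)" for d
    using m attach_edgeI(2)[OF v] by blast
  moreover have "(\<exists>z d. is_matter (attach_graph B) z \<and> {(Inr (v, s), Port_m), (z, child_port d)} \<in> edges (attach_graph B)) \<or>
     (\<exists>z. \<not> is_matter (attach_graph B) z \<and> {(Inr (v, s), Port_m), (z, Port_m)} \<in> edges (attach_graph B))"
  proof (cases s rule: rev_cases)
    case Nil
    have "{(Inr (v, s), Port_m), (Inl v, Port_m)} \<in> edges (attach_graph B)"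
      using attach_edgeI(3)[OF v] by (simp add: Nil insert_commute)
    moreover have "\<not> is_matter (attach_graph B) (Inl v)" using base_graph_label[OF B] by (simp add: is_matter_def)
    ultimately show ?thesis by blast
  next
    case (snoc t d)
    have "{(Inr (v, s), Port_m), (Inr (v, t), child_port d)} \<in> edges (attach_graph B)"
      using attach_edgeI(2)[OF v, of t d] by (simp add: snoc insert_commute)
    then show ?thesis using m by blast
  qed
  moreover have "(a = Port_m \<or> (\<exists>d. a = child_port d)) \<and> elab (attach_graph B) {(Inr (v, s), a), (z, b)} = None"
    if e: "{(Inr (v, s), a), (z, b)} \<in> edges (attach_graph B)" for z a b
  proof
    show "a = Port_m \<or> (\<exists>d. a = child_port d)" by (rule attach_edge_InrE[OF e, of v s a]) auto
    show "elab (attach_graph B) {(Inr (v, s), a), (z, b)} = None"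
      by (rule elab_attach_tree[of "(v, s)" a]) simp
  qed
  ultimately show ?thesis unfolding y matter_at_def if_P[OF m] by blast
qed

text \<open>Each instance of the condition is read off one disk of \<open>G\<close>, and that disk
  is shared with an element of \<open>Y_set\<close>, where \<open>matter_at_attach\<close> applies.
  The element depends on \<open>v\<close>, which is harmless for a local condition.\<close>

lemma matter_at_closure:
  assumes G: "pointed_graph G" and Y: "\<forall>r. \<exists>Y\<in>Y_set \<Sigma> \<Delta> \<pi>. disk r Y = disk r (iso_class G)"
    and v: "v \<in> verts G"
  shows "matter_at G v"
proof -
  obtain r where r: "v \<in> ball_verts G r" by (rule in_some_ball[OF G v])
  obtain Y where Y: "Y \<in> Y_set \<Sigma> \<Delta> \<pi>" "disk (Suc r) Y = disk (Suc r) (iso_class G)" using Y by blast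
  obtain B :: "(nat, _, _, _) pgraph" and x
    where B: "base_graph \<Sigma> \<Delta> \<pi> B" "x \<in> verts (attach_graph B)" "pointed_graph ((attach_graph B)\<lparr>ptr := x\<rparr>)"
      "Y = iso_class ((attach_graph B)\<lparr>ptr := x\<rparr>)"
    by (rule Y_setE[OF Y(1)])
  let ?A = "(attach_graph B)\<lparr>ptr := x\<rparr>"
  note pA = pointed_graph_disk[OF B(3), of "Suc r"] and pG = pointed_graph_disk[OF G, of "Suc r"]
  obtain f where f: "pgraph_iso f (disk_graph (Suc r) ?A) (disk_graph (Suc r) G)"
    using disk_eqD[OF B(3) G] Y(2) B(4) by blast
  have "v \<in> f ` ball_verts (disk_graph (Suc r) ?A) r"
    using r by (simp add: iso_ball[OF f pA pG, symmetric] ball_disk_graph[OF G])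
  then obtain y where y: "v = f y" "y \<in> ball_verts ?A r"
    by (auto simp: ball_disk_graph[OF B(3)])
  have "y \<in> verts ?A" using y(2) ball_verts_subset[OF B(3)] by blast
  then have "matter_at ?A y" using matter_at_attach[OF B(1)] by simp
  then have "matter_at (disk_graph (Suc r) ?A) y" using matter_at_disk[OF B(3) y(2)] by blast
  moreover have "y \<in> verts (disk_graph (Suc r) ?A)"
    using y(2) ball_verts_subset[OF pA, of r] by (auto simp: ball_disk_graph[OF B(3)])
  ultimately have "matter_at (disk_graph (Suc r) G) v"
    using matter_at_iso[OF f pA pG] y(1) by blast
  then show ?thesis using matter_at_disk[OF G r] by blast
qed

section \<open>Rebuilding a graph with attached trees from the local conditions\<close>

locale matter_graph =
  fixes \<Sigma> :: "'s set" and \<Delta> :: "'d set" and \<pi> :: "'p set" and G :: "('v, 's mlabel, 'd, 'p mport) pgraph"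
  assumes pointed: "pointed_graph G"
    and alphabets: "over_alphabets (Label ` \<Sigma> \<union> {Label_m}) \<Delta> (Port ` \<pi> \<union> {Port_m, Port_l, Port_r}) G"
    and matter: "v \<in> verts G \<Longrightarrow> matter_at G v"
begin

definition children :: "'v \<Rightarrow> bool \<Rightarrow> 'v" where
  "children v d = (SOME x. is_matter G x \<and> {(v, child_port d), (x, Port_m)} \<in> edges G)"

definition root :: "'v \<Rightarrow> 'v" where
  "root v = (SOME x. is_matter G x \<and> {(v, Port_m), (x, Port_m)} \<in> edges G)"

definition node :: "'v \<Rightarrow> bool list \<Rightarrow> 'v" where
  "node v s = foldl children (root v) s"

lemma child_edge:
  assumes "v \<in> verts G" "is_matter G v"
  shows "is_matter G (children v d)" "{(v, child_port d), (children v d, Port_m)} \<in> edges G"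
proof -
  have "\<exists>x. is_matter G x \<and> {(v, child_port d), (x, Port_m)} \<in> edges G"
    using matter[OF assms(1)] assms(2) by (simp add: matter_at_def)
  from someI_ex[OF this] show "is_matter G (children v d)" "{(v, child_port d), (children v d, Port_m)} \<in> edges G"
    by (simp_all add: children_def)
qed

lemma root_edge:
  assumes "v \<in> verts G" "\<not> is_matter G v"
  shows "is_matter G (root v)" "{(v, Port_m), (root v, Port_m)} \<in> edges G"
proof -
  have "\<exists>x. is_matter G x \<and> {(v, Port_m), (x, Port_m)} \<in> edges G"
    using matter[OF assms(1)] assms(2) by (simp add: matter_at_def)
  from someI_ex[OF this] show "is_matter G (root v)" "{(v, Port_m), (root v, Port_m)} \<in> edges G"
    by (simp_all add: root_def)
qed

lemma matter_edge:
  assumes "v \<in> verts G" "is_matter G v" "{(v, a), (x, b)} \<in> edges G"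
  shows "a = Port_m \<or> (\<exists>d. a = child_port d)" "elab G {(v, a), (x, b)} = None"
  using matter[OF assms(1)] assms(2,3) by (auto simp: matter_at_def)

lemma node_matter:
  assumes "v \<in> verts G" "\<not> is_matter G v"
  shows "node v s \<in> verts G \<and> is_matter G (node v s)"
proof (induction s rule: rev_induct)
  case Nil
  show ?case using root_edge[OF assms] edge_verts[OF pointed] by (auto simp: node_def)
next
  case (snoc d s)
  then show ?case
    using child_edge[of "node v s" d] edge_verts[OF pointed, of _ "children (node v s) d" Port_m]
    by (auto simp: node_def)
qed

lemma node_edge:
  assumes "v \<in> verts G" "\<not> is_matter G v"
  shows "{(node v s, child_port d), (node v (s @ [d]), Port_m)} \<in> edges G"
  using child_edge(2) node_matter[OF assms] by (simp add: node_def)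

lemma node_Nil_edge:
  assumes "v \<in> verts G" "\<not> is_matter G v"
  shows "{(v, Port_m), (node v [], Port_m)} \<in> edges G"
  using root_edge(2)[OF assms] by (simp add: node_def)

text \<open>The edge of a node at \<open>Port_m\<close> is unique and tells where the node comes
  from: it arrives at a child port of the parent, or at \<open>Port_m\<close> of a base vertex if
  the node is a root. Climbing these edges reads the word from its end, hence the reverse
  induction.\<close>

lemma node_inj:
  assumes v: "v \<in> verts G" "\<not> is_matter G v" "v' \<in> verts G" "\<not> is_matter G v'"
  shows "node v s = node v' s' \<Longrightarrow> v = v' \<and> s = s'"
proof (induction s arbitrary: s' rule: rev_induct)
  note unique = edge_unique[OF pointed]
  have root: "{(node v [], Port_m), (v, Port_m)} \<in> edges G" if "v \<in> verts G" "\<not> is_matter G v" for v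
    using node_Nil_edge[OF that] by (simp add: insert_commute)
  have step: "{(node v (s @ [d]), Port_m), (node v s, child_port d)} \<in> edges G"
    if "v \<in> verts G" "\<not> is_matter G v" for v s d
    using node_edge[OF that, of s d] by (simp add: insert_commute)
  {
    case Nil
    show ?case
    proof (cases s' rule: rev_cases)
      case Nil
      then show ?thesis using unique[OF root[OF v(1,2)], of v' Port_m] root[OF v(3,4)] \<open>node v [] = node v' s'\<close> by simp
    next
      case (snoc t d)
      then show ?thesis using unique[OF root[OF v(1,2)] , of "node v' t" "child_port d"]
        step[OF v(3,4), of t d] \<open>node v [] = node v' s'\<close> by simp
    qed
  next
    case (snoc c s)
    show ?case
    proof (cases s' rule: rev_cases)
      case Nil
      then show ?thesis using unique[OF root[OF v(3,4)] , of "node v s" "child_port c"]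
        step[OF v(1,2), of s c] snoc.prems by simp
    next
      case (snoc t d)
      then have "node v s = node v' t \<and> child_port c = (child_port d :: 'p mport)"
        using unique[OF step[OF v(1,2), of s c], of "node v' t" "child_port d"]
        step[OF v(3,4), of t d] snoc.prems by simp
      then show ?thesis using snoc.IH snoc by simp
    qed
  }
qed

text \<open>Child ports are excluded at a base vertex, so \<open>a\<close> is some
  \<open>Port q\<close>. A matter vertex at the other end would be entered through
  \<open>Port_m\<close> or a child port; the edge there is its upward edge or the edge to a child,
  and the far port of these is \<open>Port_m\<close> or a child port, never
  \<open>Port q\<close>.\<close>

lemma base_edge:
  assumes v: "v \<in> verts G" "\<not> is_matter G v" and e: "{(v, a), (x, b)} \<in> edges G" and a: "a \<noteq> Port_m"
  shows "a \<in> Port ` \<pi>" "\<not> is_matter G x"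
proof -
  have ports: "c \<in> Port ` \<pi> \<or> c = Port_m \<or> (\<exists>d. c = child_port d)" if "(u, c) \<in> {(v, a), (x, b)}" for u c
  proof -
    have "snd ` {(v, a), (x, b)} \<subseteq> Port ` \<pi> \<union> {Port_m, Port_l, Port_r}"
      using alphabets e unfolding over_alphabets_def by blast
    then have "c \<in> Port ` \<pi> \<union> {Port_m, Port_l, Port_r}" using that by force
    then show ?thesis by (metis UnE child_port_def empty_iff insert_iff)
  qed
  have "a \<noteq> child_port d" for d using matter[OF v(1)] v(2) e by (auto simp: matter_at_def)
  then show "a \<in> Port ` \<pi>" using ports[of v a] a by auto
  then obtain q where q: "a = Port q" by blast
  have x: "x \<in> verts G" using edge_verts[OF pointed e, of x b] by simp
  have e': "{(x, b), (v, a)} \<in> edges G" using e by (simp add: insert_commute)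
  show "\<not> is_matter G x"
  proof
    assume m: "is_matter G x"
    have "b = Port_m \<or> (\<exists>d. b = child_port d)" using matter_edge(1)[OF x m e'] .
    then show False
    proof
      assume "b = Port_m"
      moreover obtain y c where "{(x, Port_m), (y, c)} \<in> edges G" "c = Port_m \<or> (\<exists>d. c = child_port d)"
        using matter[OF x] m unfolding matter_at_def by auto
      ultimately have "a = Port_m \<or> (\<exists>d. a = child_port d)"
        using edge_unique[OF pointed e', of y c] by simp
      then show False using q by auto
    next
      assume "\<exists>d. b = child_port d"
      then show False using edge_unique[OF pointed e'] child_edge(2)[OF x m] q by auto
    qed
  qed
qed

definition base :: "'v \<Rightarrow> ('v, 's mlabel, 'd, 'p mport) pgraph" where
  "base c = \<lparr>verts = {v \<in> verts G. \<not> is_matter G v},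
     edges = {e \<in> edges G. fst ` e \<subseteq> {v \<in> verts G. \<not> is_matter G v}},
     vlab = vlab G |` {v \<in> verts G. \<not> is_matter G v},
     elab = elab G |` {e \<in> edges G. fst ` e \<subseteq> {v \<in> verts G. \<not> is_matter G v}},
     ptr = c\<rparr>"

lemma base_edge_iff:
  "{(v, a), (x, b)} \<in> edges (base c) \<longleftrightarrow>
     {(v, a), (x, b)} \<in> edges G \<and> v \<in> verts (base c) \<and> x \<in> verts (base c)"
  by (auto simp: base_def)

text \<open>The candidate isomorphism from the base part with its trees attached back onto
  \<open>G\<close>.\<close>

definition place :: "'v + 'v \<times> bool list \<Rightarrow> 'v" where
  "place y = (case y of Inl v \<Rightarrow> v | Inr (v, s) \<Rightarrow> node v s)"

lemma place_simps [simp]: "place (Inl v) = v" "place (Inr (v, s)) = node v s"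
  by (simp_all add: place_def)

lemma verts_base [simp]: "v \<in> verts (base c) \<longleftrightarrow> v \<in> verts G \<and> \<not> is_matter G v"
  by (simp add: base_def)

text \<open>An excursion into a tree can return to the base part only through the base vertex it
  left from. Hence along a walk of \<open>G\<close> one can maintain a base vertex \<open>b\<close>,
  a walk \<open>p\<close> to it that avoids matter, and a position at \<open>b\<close> or in its
  tree. This yields both surjectivity of \<open>place\<close> and connectedness of
  \<open>base c\<close>.\<close>

lemma place_reachable:
  assumes c: "c \<in> verts G" "\<not> is_matter G c" and w: "walk G w x y"
    and "b \<in> verts G" "\<not> is_matter G b" "walk (base c) p c b" "x = b \<or> x = node b s"
  shows "\<exists>b p s. b \<in> verts G \<and> \<not> is_matter G b \<and> walk (base c) p c b \<and> (y = b \<or> y = node b s)"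
  using w assms(4-7)
proof (induction w arbitrary: x b p s)
  case Nil
  then show ?case by auto
next
  case (Cons l w)
  obtain a a' where l: "l = (a, a')" by fastforce
  then obtain z where z: "{(x, a), (z, a')} \<in> edges G" "walk G w z y" using Cons.prems(1) by auto
  have zv: "z \<in> verts G" using edge_verts[OF pointed z(1), of z a'] by simp
  note b = Cons.prems(2,3) and p = Cons.prems(4)
  note IH = Cons.IH[OF z(2)]
  note unique = edge_unique[OF pointed z(1)]
  consider "x = b" "a = Port_m" | "x = b" "a \<noteq> Port_m" | "x = node b s" using Cons.prems(5) by blast
  then show ?case
  proof cases
    case 1
    then have "z = node b []" using unique node_Nil_edge[OF b] by blast
    then show ?thesis using IH[OF b p] by blast
  next
    case 2
    then have zm: "\<not> is_matter G z" using base_edge(2)[OF b] z(1) by blast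
    then have "walk (base c) [(a, a')] b z" using z(1) b zv 2 by (simp add: base_edge_iff)
    then have "walk (base c) (p @ [(a, a')]) c z" by (rule walk_trans[OF p])
    then show ?thesis using IH[OF zv zm] by blast
  next
    case 3
    note m = node_matter[OF b, of s]
    consider "a = Port_m" | d where "a = child_port d"
      using matter_edge(1)[of x a z a'] m z(1) 3 by blast
    then show ?thesis
    proof cases
      case 1
      show ?thesis
      proof (cases s rule: rev_cases)
        case Nil
        then have "{(x, Port_m), (b, Port_m)} \<in> edges G"
          using node_Nil_edge[OF b] 3 by (simp add: insert_commute)
        then have "z = b" using unique 1 by blast
        then show ?thesis using IH[OF b p] by blast
      next
        case (snoc t d)
        then have "{(x, Port_m), (node b t, child_port d)} \<in> edges G"
          using node_edge[OF b, of t d] 3 by (simp add: insert_commute)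
        then have "z = node b t" using unique 1 by blast
        then show ?thesis using IH[OF b p] by blast
      qed
    next
      case 2
      then have "z = node b (s @ [d])" using unique node_edge[OF b, of s d] 3 by blast
      then show ?thesis using IH[OF b p] by blast
    qed
  qed
qed

lemma place_surj:
  assumes c: "c \<in> verts G" "\<not> is_matter G c" and y: "y \<in> verts G"
  obtains b p s where "b \<in> verts G" "\<not> is_matter G b" "walk (base c) p c b" "y = b \<or> y = node b s"
proof -
  obtain w where w: "walk G w c y" by (rule connectedE[OF pointed c(1) y])
  have "walk (base c) [] c c" using c by simp
  then show ?thesis using that place_reachable[OF c w c] by blast
qed

lemma base_graph_base:
  assumes c: "c \<in> verts G" "\<not> is_matter G c"
  shows "base_graph \<Sigma> \<Delta> \<pi> (base c)"
proof -
  let ?B = "base c"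
  have V: "verts ?B \<subseteq> verts G" and E: "edges ?B \<subseteq> edges G" by (auto simp: base_def)
  have fst: "fst ` e \<subseteq> verts ?B" if "e \<in> edges ?B" for e using that by (simp add: base_def)
  have "\<forall>u\<in>verts ?B. \<forall>v\<in>verts ?B. \<exists>w. walk ?B w u v"
  proof (rule connectedI[OF fst])
    fix x assume "x \<in> verts ?B"
    then have x: "x \<in> verts G" "\<not> is_matter G x" by auto
    obtain b p s where b: "b \<in> verts G" "\<not> is_matter G b" "walk (base c) p c b" "x = b \<or> x = node b s"
      by (rule place_surj[OF c x(1)])
    then have "x = b" using node_matter[OF b(1,2)] x(2) by blast
    then show "\<exists>w. walk ?B w c x" using b(3) by blast
  qed
  moreover have "countable (verts ?B)"
    using pointed countable_subset[OF V] by (simp add: pointed_graph_def)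
  moreover have "\<forall>e\<in>edges ?B. card e = 2 \<and> fst ` e \<subseteq> verts ?B"
  proof
    fix e assume e: "e \<in> edges ?B"
    then have "card e = 2" using E pointed by (auto simp: pointed_graph_def)
    then show "card e = 2 \<and> fst ` e \<subseteq> verts ?B" using fst[OF e] by blast
  qed
  moreover have "\<forall>e\<in>edges ?B. \<forall>e'\<in>edges ?B. e \<inter> e' \<noteq> {} \<longrightarrow> e = e'"
  proof (intro ballI impI)
    fix e e' assume e: "e \<in> edges ?B" "e' \<in> edges ?B" "e \<inter> e' \<noteq> {}"
    then obtain x where x: "x \<in> e" "x \<in> e'" by blast
    have "e \<in> edges G" "e' \<in> edges G" using e(1,2) E by auto
    then show "e = e'" using x by (rule edge_eqI[OF pointed])
  qed
  moreover have "dom (vlab ?B) \<subseteq> verts ?B" "dom (elab ?B) \<subseteq> edges ?B" by (auto simp: base_def)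
  moreover have "ptr ?B \<in> verts ?B" using c by (simp add: base_def)
  ultimately have "pointed_graph ?B" unfolding pointed_graph_def by blast
  moreover have "over_alphabets (Label ` \<Sigma>) \<Delta> (Port ` \<pi>) ?B"
  proof -
    have "s \<in> Label ` \<Sigma>" if "vlab ?B v = Some s" for v s
    proof -
      have "v \<in> verts G" "\<not> is_matter G v" "vlab G v = Some s"
        using that by (auto simp: base_def restrict_map_def split: if_splits)
      then show ?thesis using alphabets by (auto simp: over_alphabets_def ran_def is_matter_def)
    qed
    moreover have "d \<in> \<Delta>" if "elab ?B e = Some d" for e d
    proof -
      have "elab G e = Some d" using that by (auto simp: base_def restrict_map_def split: if_splits)
      then show ?thesis using alphabets by (auto simp: over_alphabets_def ran_def)
    qed
    moreover have "a \<in> Port ` \<pi>" if e: "e \<in> edges ?B" "(v, a) \<in> e" for e v a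
    proof -
      have eG: "e \<in> edges G" using e(1) E by blast
      obtain x b where xb: "e = {(v, a), (x, b)}" by (rule edge_atE[OF pointed eG e(2)])
      have vx: "v \<in> verts G" "\<not> is_matter G v" "\<not> is_matter G x"
        using e(1) unfolding xb base_edge_iff by auto
      \<comment> \<open>\<open>Port_m\<close> of a base vertex is taken by the root of its tree,
        which was removed.\<close>
      have "a \<noteq> Port_m"
      proof
        assume "a = Port_m"
        then have "x = root v" using edge_unique[OF pointed] eG xb root_edge(2)[OF vx(1,2)] by blast
        then show False using vx root_edge(1) by blast
      qed
      then show ?thesis using base_edge(1)[OF vx(1,2)] eG xb by blast
    qed
    ultimately show ?thesis by (fastforce simp: over_alphabets_def ran_def)
  qed
  ultimately show ?thesis by (simp add: base_graph_def)
qed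

text \<open>With \<open>isoI_ports\<close> it is enough to match the ports in use. A matter vertex
  can only use \<open>Port_m\<close> and the child ports, all of which are in use in the tree; at a
  base vertex \<open>Port_m\<close> leads to the tree and every other port to a base vertex, by
  \<open>base_edge\<close>.\<close>

lemma iso_place:
  assumes c: "c \<in> verts G" "\<not> is_matter G c"
  shows "pgraph_iso place (attach_graph (base c)) (G\<lparr>ptr := c\<rparr>)"
proof (rule isoI_ports)
  let ?A = "attach_graph (base c)"
  note B = base_graph_base[OF c]
  show "pointed_graph ?A" by (rule pointed_graph_attach[OF B])
  show "pointed_graph (G\<lparr>ptr := c\<rparr>)" by (rule pointed_graph_ptr[OF pointed c(1)])
  have "inj_on place (verts ?A)"
  proof (rule inj_onI)
    fix x y assume xy: "x \<in> verts ?A" "y \<in> verts ?A" "place x = place y"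
    show "x = y"
    proof (cases x; cases y)
      fix v u assume "x = Inl v" "y = Inl u"
      then show ?thesis using xy by simp
    next
      fix v q assume q: "x = Inl v" "y = Inr q"
      obtain u s where "q = (u, s)" by fastforce
      then show ?thesis using xy node_matter[of u s] q by auto
    next
      fix v q assume q: "x = Inr q" "y = Inl v"
      obtain u s where "q = (u, s)" by fastforce
      then show ?thesis using xy node_matter[of u s] q by auto
    next
      fix q q' assume q: "x = Inr q" "y = Inr q'"
      obtain u s u' s' where "q = (u, s)" "q' = (u', s')" by fastforce
      then show ?thesis using xy node_inj[of u u' s s'] q by auto
    qed
  qed
  moreover have "place y \<in> verts G" if "y \<in> verts ?A" for y
  proof (cases y)
    case (Inl v)
    then show ?thesis using that by simp
  next
    case (Inr q)
    then show ?thesis using that node_matter by (cases q) simp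
  qed
  moreover have "y \<in> place ` verts ?A" if y: "y \<in> verts G" for y
  proof -
    obtain b p s where b: "b \<in> verts G" "\<not> is_matter G b" "y = b \<or> y = node b s"
      by (rule place_surj[OF c y])
    from b(3) show ?thesis
    proof
      assume "y = b"
      then show ?thesis using b(1,2) by (intro image_eqI[of _ _ "Inl b"]) simp_all
    next
      assume "y = node b s"
      then show ?thesis using b(1,2) by (intro image_eqI[of _ _ "Inr (b, s)"]) simp_all
    qed
  qed
  ultimately show "bij_betw place (verts ?A) (verts (G\<lparr>ptr := c\<rparr>))"
    unfolding bij_betw_def by auto
  have map_base: "map_prod place id ` map_prod Inl id ` e = e" for e :: "('v \<times> 'p mport) set"
    by (force simp: image_image)
  have baseE: "e \<in> edges G" "elab (base c) e = elab G e" if "e \<in> edges (base c)" for e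
    using that by (auto simp: base_def)
  show "map_prod place id ` e \<in> edges (G\<lparr>ptr := c\<rparr>)" if "e \<in> edges ?A" for e
    using that[unfolded attach_edge_iff]
  proof (elim disjE bexE exE)
    fix e0 assume "e0 \<in> edges (base c)" "e = map_prod Inl id ` e0"
    then show ?thesis using baseE(1) by (simp add: map_base)
  next
    fix v s d assume "v \<in> verts (base c)" "e = {(Inr (v, s), child_port d), (Inr (v, s @ [d]), Port_m)}"
    then show ?thesis using node_edge by simp
  next
    fix v assume "v \<in> verts (base c)" "e = {(Inl v, Port_m), (Inr (v, []), Port_m)}"
    then show ?thesis using node_Nil_edge by simp
  qed
  show "elab (G\<lparr>ptr := c\<rparr>) (map_prod place id ` e) = elab ?A e" if "e \<in> edges ?A" for e
    using that[unfolded attach_edge_iff]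
  proof (elim disjE bexE exE)
    fix e0 assume "e0 \<in> edges (base c)" "e = map_prod Inl id ` e0"
    then show ?thesis using baseE(2) by (simp add: map_base elab_attach_base)
  next
    fix v s d assume v: "v \<in> verts (base c)" "e = {(Inr (v, s), child_port d), (Inr (v, s @ [d]), Port_m)}"
    then show ?thesis
      using node_edge matter_edge(2)[of "node v s"] node_matter by simp
  next
    fix v assume v: "v \<in> verts (base c)" "e = {(Inl v, Port_m), (Inr (v, []), Port_m)}"
    then have "elab G {(node v [], Port_m), (v, Port_m)} = None"
      using node_Nil_edge matter_edge(2)[of "node v []"] node_matter by (simp add: insert_commute)
    then show ?thesis using v by (simp add: insert_commute)
  qed
  show "\<exists>e'\<in>edges ?A. (u, a) \<in> e'"
    if e: "e \<in> edges (G\<lparr>ptr := c\<rparr>)" and u: "u \<in> verts ?A" and ua: "(place u, a) \<in> e" for e u a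
  proof (cases u)
    case (Inl v)
    then have v: "v \<in> verts G" "\<not> is_matter G v" using u by simp_all
    have eG: "e \<in> edges G" "(v, a) \<in> e" using e ua Inl by simp_all
    show ?thesis
    proof (cases "a = Port_m")
      case True
      then show ?thesis using attach_edgeI(3)[of v "base c"] v Inl
        by (intro bexI[of _ "{(Inl v, Port_m), (Inr (v, []), Port_m)}"]) simp_all
    next
      case False
      obtain x b where xb: "e = {(v, a), (x, b)}" by (rule edge_atE[OF pointed eG])
      have "x \<in> verts G" using edge_verts[OF pointed eG(1), of x b] xb by simp
      moreover have "\<not> is_matter G x" using base_edge(2)[OF v _ False] eG(1) xb by blast
      ultimately have "e \<in> edges (base c)" using v eG(1) unfolding xb base_edge_iff by simp
      then have "map_prod Inl id ` e \<in> edges ?A" by (rule attach_edgeI(1))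
      moreover have "(u, a) \<in> map_prod Inl id ` e" using eG(2) Inl by force
      ultimately show ?thesis by blast
    qed
  next
    case (Inr q)
    then obtain v s where q: "u = Inr (v, s)" by (cases q) auto
    then have v: "v \<in> verts G" "\<not> is_matter G v" and vB: "v \<in> verts (base c)" using u by simp_all
    have eG: "e \<in> edges G" "(node v s, a) \<in> e" using e ua q by simp_all
    obtain x b where xb: "e = {(node v s, a), (x, b)}" by (rule edge_atE[OF pointed eG])
    consider "a = Port_m" | d where "a = child_port d"
      using matter_edge(1)[of "node v s" a x b] node_matter[OF v] eG(1) xb by blast
    then show ?thesis
    proof cases
      case 1
      show ?thesis
      proof (cases s rule: rev_cases)
        case Nil
        then show ?thesis using attach_edgeI(3)[OF vB] 1 q by blast
      next
        case (snoc t d)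
        then show ?thesis using attach_edgeI(2)[OF vB, of t d] 1 q by blast
      qed
    next
      case 2
      then show ?thesis using attach_edgeI(2)[OF vB, of s d] q by blast
    qed
  qed
  show "vlab (G\<lparr>ptr := c\<rparr>) (place y) = vlab ?A y" if "y \<in> verts ?A" for y
  proof (cases y)
    case (Inl v)
    then show ?thesis using that by (simp add: base_def)
  next
    case (Inr q)
    then show ?thesis using that node_matter by (cases q) (simp add: is_matter_def)
  qed
  show "ptr (G\<lparr>ptr := c\<rparr>) = place (ptr ?A)" by (simp add: base_def)
qed

end

section \<open>The closure\<close>

lemma Y_setI:
  fixes B :: "(nat, 's mlabel, 'd, 'p mport) pgraph"
  shows "base_graph \<Sigma> \<Delta> \<pi> B \<Longrightarrow> x \<in> verts (attach_graph B) \<Longrightarrow>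
    iso_class ((attach_graph B)\<lparr>ptr := x\<rparr>) \<in> Y_set \<Sigma> \<Delta> \<pi>"
  unfolding Y_set_iff by blast

text \<open>The pointer of \<open>G\<close> may lie anywhere, also deep in a tree, whereas
  \<open>iso_place\<close> points at \<open>c\<close>. Since \<open>Y_set\<close> allows every
  pointer, the isomorphism is re-pointed at the preimage of \<open>ptr G\<close>.\<close>

lemma Y_set_if_base_vertex:
  fixes G :: "(nat, 's mlabel, 'd, 'p mport) pgraph"
  assumes "matter_graph \<Sigma> \<Delta> \<pi> G" and c: "c \<in> verts G" "\<not> is_matter G c"
  shows "iso_class G \<in> Y_set \<Sigma> \<Delta> \<pi>"
proof -
  interpret matter_graph \<Sigma> \<Delta> \<pi> G by fact
  let ?A = "attach_graph (base c)"
  note B = base_graph_base[OF c]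
  have "ptr G \<in> verts (G\<lparr>ptr := c\<rparr>)" using ptr_in_verts[OF pointed] by simp
  then obtain x where x: "x \<in> verts ?A" "ptr G = place x" by (rule iso_surj[OF iso_place[OF c]])
  have "pgraph_iso place (?A\<lparr>ptr := x\<rparr>) (G\<lparr>ptr := place x\<rparr>)"
    using iso_ptr[OF iso_place[OF c], of x] by simp
  then have "pgraph_iso place (?A\<lparr>ptr := x\<rparr>) G" by (simp add: x(2)[symmetric])
  then have "iso_class G = iso_class (?A\<lparr>ptr := x\<rparr>)"
    using iso_class_eqI pointed_graph_ptr[OF pointed_graph_attach[OF B] x(1)] by metis
  then show ?thesis using B x(1) unfolding Y_set_iff by blast
qed

lemma Y_set_subset_closure: "Y_set \<Sigma> \<Delta> \<pi> \<subseteq> Y_closure \<Sigma> \<Delta> \<pi>"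
proof
  fix Y assume Y: "Y \<in> Y_set \<Sigma> \<Delta> \<pi>"
  then obtain B :: "(nat, _, _, _) pgraph" and x
    where B: "base_graph \<Sigma> \<Delta> \<pi> B" "x \<in> verts (attach_graph B)" "pointed_graph ((attach_graph B)\<lparr>ptr := x\<rparr>)"
      "Y = iso_class ((attach_graph B)\<lparr>ptr := x\<rparr>)"
    by (rule Y_setE)
  obtain H :: "(nat, _, _, _) pgraph" and f
    where H: "pointed_graph H" "pgraph_iso f ((attach_graph B)\<lparr>ptr := x\<rparr>) H"
      "iso_class ((attach_graph B)\<lparr>ptr := x\<rparr>) = iso_class H"
    by (rule nat_representative[OF B(3)])
  have "over_alphabets (Label ` \<Sigma> \<union> {Label_m}) \<Delta> (Port ` \<pi> \<union> {Port_m, Port_l, Port_r}) ((attach_graph B)\<lparr>ptr := x\<rparr>)"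
    using over_alphabets_attach[OF B(1)] by (simp add: over_alphabets_def)
  then have "over_alphabets (Label ` \<Sigma> \<union> {Label_m}) \<Delta> (Port ` \<pi> \<union> {Port_m, Port_l, Port_r}) H"
    by (rule over_alphabets_iso[OF H(2) B(3) H(1)])
  then have "Y \<in> X_ext \<Sigma> \<Delta> \<pi>" using H(1,3) B(4) unfolding pgms_def by blast
  then show "Y \<in> Y_closure \<Sigma> \<Delta> \<pi>" using Y unfolding Y_closure_def by blast
qed

lemma Y_closureE:
  assumes "X \<in> Y_closure \<Sigma> \<Delta> \<pi>"
  obtains G :: "(nat, 's mlabel, 'd, 'p mport) pgraph"
  where "matter_graph \<Sigma> \<Delta> \<pi> G" "pointed_graph G" "X = iso_class G"
proof -
  have "X \<in> X_ext \<Sigma> \<Delta> \<pi>" and Y: "\<forall>r. \<exists>Y\<in>Y_set \<Sigma> \<Delta> \<pi>. disk r Y = disk r X"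
    using assms by (simp_all add: Y_closure_def)
  then obtain G :: "(nat, 's mlabel, 'd, 'p mport) pgraph"
    where G: "pointed_graph G" "X = iso_class G"
      "over_alphabets (Label ` \<Sigma> \<union> {Label_m}) \<Delta> (Port ` \<pi> \<union> {Port_m, Port_l, Port_r}) G"
    unfolding pgms_def by blast
  have "matter_graph \<Sigma> \<Delta> \<pi> G"
    using G(1,3) matter_at_closure[OF G(1) Y[unfolded G(2)]] by (simp add: matter_graph_def)
  then show ?thesis using that G(1,2) by blast
qed

lemma represented_closure: "X \<in> Y_closure \<Sigma> \<Delta> \<pi> \<Longrightarrow> represented X"
  by (rule Y_closureE) (auto simp: represented_iso_class)

lemma Y_set_shift:
  assumes "Y \<in> Y_set \<Sigma> \<Delta> \<pi>" "u \<in> V Y"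
  shows "shift Y u \<in> Y_set \<Sigma> \<Delta> \<pi>"
proof -
  obtain B :: "(nat, _, _, _) pgraph" and x
    where B: "base_graph \<Sigma> \<Delta> \<pi> B" "x \<in> verts (attach_graph B)" "pointed_graph ((attach_graph B)\<lparr>ptr := x\<rparr>)"
      "Y = iso_class ((attach_graph B)\<lparr>ptr := x\<rparr>)"
    by (rule Y_setE[OF assms(1)])
  obtain y where y: "y \<in> verts (attach_graph B)" "u = paths_to ((attach_graph B)\<lparr>ptr := x\<rparr>) y"
    using assms(2) by (auto simp: B(4) V_iso_class[OF B(3)])
  have "shift Y u = iso_class ((attach_graph B)\<lparr>ptr := y\<rparr>)"
    using shift_iso_class[OF B(3), of y] y by (simp add: B(4))
  then show ?thesis using B(1) y(1) unfolding Y_set_iff by blast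
qed

text \<open>A shift is undone by shifting back to the old pointer. The equivalence makes the case
  distinction in the definition of the extension compatible with shifts.\<close>

lemma Y_set_shift_iff:
  assumes "represented X" "u \<in> V X"
  shows "shift X u \<in> Y_set \<Sigma> \<Delta> \<pi> \<longleftrightarrow> X \<in> Y_set \<Sigma> \<Delta> \<pi>"
proof
  obtain G :: "(nat, _, _, _) pgraph" where G: "pointed_graph G" "X = iso_class G"
    using assms(1) by (auto simp: represented_def)
  obtain v where v: "v \<in> verts G" "u = paths_to G v" using assms(2) G by (auto simp: V_iso_class)
  let ?H = "G\<lparr>ptr := v\<rparr>"
  have H: "pointed_graph ?H" by (rule pointed_graph_ptr[OF G(1) v(1)])
  have s: "shift X u = iso_class ?H" using shift_iso_class[OF G(1) v(1)] G(2) v(2) by simp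
  have p: "ptr G \<in> verts ?H" using ptr_in_verts[OF G(1)] by simp
  have "shift (shift X u) (paths_to ?H (ptr G)) = X"
    unfolding s using shift_iso_class[OF H p] by (simp add: G(2))
  moreover have "paths_to ?H (ptr G) \<in> V (shift X u)" using p by (simp add: s V_iso_class[OF H])
  moreover assume "shift X u \<in> Y_set \<Sigma> \<Delta> \<pi>"
  ultimately show "X \<in> Y_set \<Sigma> \<Delta> \<pi>" using Y_set_shift by metis
qed (use Y_set_shift assms in blast)

text \<open>The balls have radius \<open>n\<close> and not \<open>n + 1\<close>, since vertices on
  the boundary of a disk lose their labels.\<close>

lemma disk_eq_matter:
  assumes G: "pointed_graph G" and H: "pointed_graph H" and d: "disk n (iso_class G) = disk n (iso_class H)"
    and all: "\<forall>v\<in>ball_verts G n. is_matter G v" and u: "u \<in> ball_verts H n"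
  shows "is_matter H u"
proof -
  obtain f where f: "pgraph_iso f (disk_graph n G) (disk_graph n H)" by (rule disk_eqD[OF G H d])
  note pG = pointed_graph_disk[OF G, of n] and pH = pointed_graph_disk[OF H, of n]
  have "u \<in> f ` ball_verts (disk_graph n G) n"
    using u by (simp add: iso_ball[OF f pG pH, symmetric] ball_disk_graph[OF H])
  then obtain v where v: "u = f v" "v \<in> ball_verts G n" by (auto simp: ball_disk_graph[OF G])
  have "v \<in> verts (disk_graph n G)"
    using v(2) ball_verts_subset[OF pG, of n] by (auto simp: ball_disk_graph[OF G])
  then have "is_matter (disk_graph n H) u = is_matter (disk_graph n G) v"
    using iso_is_matter[OF f] v(1) by simp
  then show ?thesis using all u v(2) by (simp add: is_matter_disk)
qed

section \<open>Deep inside the invisible matter\<close>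

text \<open>The right-hand side mentions none of \<open>b\<close>, \<open>B\<close> and
  \<open>p\<close>, so the parts below any two nodes, even in different graphs, can be
  compared.\<close>

lemma subtree_edge_iff:
  assumes "b \<in> verts B"
  shows "{(Inr (b, p @ t), a), (Inr (b, p @ t'), c)} \<in> edges (attach_graph B) \<longleftrightarrow>
    {(t, a), (t', c)} \<in> tree_edges"
proof
  assume e: "{(Inr (b, p @ t), a), (Inr (b, p @ t'), c)} \<in> edges (attach_graph B)"
  have "(Inr (b, p @ t), a) \<in> {(Inr (b, p @ t), a), (Inr (b, p @ t'), c)}" by simp
  with e show "{(t, a), (t', c)} \<in> tree_edges"
  proof (cases rule: attach_edge_InrE)
    case (child d)
    then have "t' = t @ [d]" "c = Port_m" by (auto simp: doubleton_eq_iff)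
    then show ?thesis using child(2) unfolding tree_edges_eq by blast
  next
    case (parent q d)
    then have "Inr (b, p @ t') = Inr (b, q)" "c = child_port d" by (auto simp: doubleton_eq_iff)
    then have "t = t' @ [d]" "c = child_port d" using parent(3) by auto
    then show ?thesis using parent(2) unfolding tree_edges_eq by (auto simp: insert_commute)
  next
    case root
    then show ?thesis by (auto simp: doubleton_eq_iff)
  qed
next
  assume "{(t, a), (t', c)} \<in> tree_edges"
  then obtain s d where "{(t, a), (t', c)} = {(s, child_port d), (s @ [d], Port_m)}"
    unfolding tree_edges_eq by blast
  then have eq: "{(Inr (b, p @ t), a), (Inr (b, p @ t'), c)} =
      {(Inr (b, p @ s), child_port d), (Inr (b, (p @ s) @ [d]), Port_m)}"
    by (auto simp: doubleton_eq_iff)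
  show "{(Inr (b, p @ t), a), (Inr (b, p @ t'), c)} \<in> edges (attach_graph B)"
    unfolding eq by (rule attach_edgeI(2)[OF assms])
qed

lemma subtree_step:
  assumes "{(Inr (b, p @ t), a), (z, c)} \<in> edges (attach_graph B)" "t \<noteq> []"
  obtains t' where "z = Inr (b, p @ t')" "length t \<le> Suc (length t')"
proof -
  have "(Inr (b, p @ t), a) \<in> {(Inr (b, p @ t), a), (z, c)}" by simp
  with assms(1) show ?thesis
  proof (cases rule: attach_edge_InrE)
    case (child d)
    then have "z = Inr (b, p @ (t @ [d]))" by (auto simp: doubleton_eq_iff)
    then show ?thesis using that[of "t @ [d]"] by simp
  next
    case (parent q d)
    then have z: "z = Inr (b, q)" by (auto simp: doubleton_eq_iff)
    obtain t' d' where t: "t = t' @ [d']" using assms(2) by (cases t rule: rev_cases) auto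
    then have "q = p @ t'" using parent(3) by simp
    then show ?thesis using that[of t'] z t by simp
  next
    case root
    then show ?thesis using assms(2) by simp
  qed
qed

text \<open>A walk cannot leave the subtree below \<open>p\<close> in fewer steps than the depth of its start.\<close>

lemma subtree_walk:
  assumes b: "b \<in> verts B" "b' \<in> verts B'"
  shows "walk (attach_graph B) w (Inr (b, p @ t)) z \<Longrightarrow> length w \<le> length t \<Longrightarrow>
    \<exists>t'. z = Inr (b, p @ t') \<and> walk (attach_graph B') w (Inr (b', p' @ t)) (Inr (b', p' @ t'))"
proof (induction w arbitrary: t)
  case Nil
  then show ?case using b by auto
next
  case (Cons l w)
  then obtain y where y: "{(Inr (b, p @ t), fst l), (y, snd l)} \<in> edges (attach_graph B)"
    "walk (attach_graph B) w y z" by auto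
  have "t \<noteq> []" using Cons.prems(2) by auto
  from y(1) this obtain u where u: "y = Inr (b, p @ u)" "length t \<le> Suc (length u)" by (rule subtree_step)
  have "length w \<le> length u" using Cons.prems(2) u(2) by simp
  then obtain t' where t': "z = Inr (b, p @ t')"
      "walk (attach_graph B') w (Inr (b', p' @ u)) (Inr (b', p' @ t'))"
    using Cons.IH[of u] y(2) u(1) by blast
  have "{(Inr (b', p' @ t), fst l), (Inr (b', p' @ u), snd l)} \<in> edges (attach_graph B')"
    using y(1) unfolding u(1) subtree_edge_iff[OF b(1)] subtree_edge_iff[OF b(2)] .
  then show ?case using t' by auto
qed

lemma subtree_ball:
  fixes B :: "('v, 's mlabel, 'd, 'p mport) pgraph" and B' :: "('w, 's mlabel, 'd, 'p mport) pgraph"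
  assumes b: "b \<in> verts B" "b' \<in> verts B'" and k: "k \<le> length s"
    and z: "z \<in> ball_verts ((attach_graph B)\<lparr>ptr := Inr (b, p @ s)\<rparr>) k"
  obtains t where "z = Inr (b, p @ t)"
    "Inr (b', p' @ t) \<in> ball_verts ((attach_graph B')\<lparr>ptr := Inr (b', p' @ s)\<rparr>) k"
proof -
  obtain w where w: "length w \<le> k" "walk (attach_graph B) w (Inr (b, p @ s)) z"
    using z by (auto simp: ball_verts_def)
  then obtain t where "z = Inr (b, p @ t)" "walk (attach_graph B') w (Inr (b', p' @ s)) (Inr (b', p' @ t))"
    using subtree_walk[OF b w(2), of p'] k by auto
  then show ?thesis using that w(1) by (auto simp: ball_verts_def)
qed

lemma subtree_ball_iff:
  fixes B :: "('v, 's mlabel, 'd, 'p mport) pgraph" and B' :: "('w, 's mlabel, 'd, 'p mport) pgraph"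
  assumes b: "b \<in> verts B" "b' \<in> verts B'" and k: "k \<le> length s"
  shows "Inr (b, p @ t) \<in> ball_verts ((attach_graph B)\<lparr>ptr := Inr (b, p @ s)\<rparr>) k \<longleftrightarrow>
    Inr (b', p' @ t) \<in> ball_verts ((attach_graph B')\<lparr>ptr := Inr (b', p' @ s)\<rparr>) k"
proof
  assume "Inr (b, p @ t) \<in> ball_verts ((attach_graph B)\<lparr>ptr := Inr (b, p @ s)\<rparr>) k"
  then obtain t' where "Inr (b, p @ t) = (Inr (b, p @ t') :: 'v + 'v \<times> bool list)"
      "Inr (b', p' @ t') \<in> ball_verts ((attach_graph B')\<lparr>ptr := Inr (b', p' @ s)\<rparr>) k"
    by (rule subtree_ball[OF b k, where p' = p'])
  then show "Inr (b', p' @ t) \<in> ball_verts ((attach_graph B')\<lparr>ptr := Inr (b', p' @ s)\<rparr>) k" by simp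
next
  assume "Inr (b', p' @ t) \<in> ball_verts ((attach_graph B')\<lparr>ptr := Inr (b', p' @ s)\<rparr>) k"
  then obtain t' where "Inr (b', p' @ t) = (Inr (b', p' @ t') :: 'w + 'w \<times> bool list)"
      "Inr (b, p @ t') \<in> ball_verts ((attach_graph B)\<lparr>ptr := Inr (b, p @ s)\<rparr>) k"
    by (rule subtree_ball[OF b(2,1) k, where p' = p])
  then show "Inr (b, p @ t) \<in> ball_verts ((attach_graph B)\<lparr>ptr := Inr (b, p @ s)\<rparr>) k" by simp
qed

text \<open>Vertices of the disk are at distance at most \<open>m + 1\<close> from the pointer, so
  with depth \<open>Suc m\<close> below \<open>p\<close> the disk stays in the subtree below
  \<open>p\<close>. Inside it every vertex is labelled \<open>m\<close> and no edge is labelled,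
  whence the labels agree.\<close>

lemma subtree_disk_iso:
  fixes B :: "('v, 's mlabel, 'd, 'p mport) pgraph" and B' :: "('w, 's mlabel, 'd, 'p mport) pgraph"
  assumes B: "base_graph \<Sigma> \<Delta> \<pi> B" "b \<in> verts B" and B': "base_graph \<Sigma>' \<Delta>' \<pi>' B'" "b' \<in> verts B'"
    and m: "Suc m \<le> length s"
  obtains f where
    "pgraph_iso f (disk_graph m ((attach_graph B)\<lparr>ptr := Inr (b, p @ s)\<rparr>))
       (disk_graph m ((attach_graph B')\<lparr>ptr := Inr (b', p' @ s)\<rparr>))"
    "\<And>t. f (Inr (b, p @ t)) = Inr (b', p' @ t)"
proof -
  let ?G = "(attach_graph B)\<lparr>ptr := Inr (b, p @ s)\<rparr>" and ?H = "(attach_graph B')\<lparr>ptr := Inr (b', p' @ s)\<rparr>"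
  let ?D = "disk_graph m ?G" and ?E = "disk_graph m ?H"
  \<comment> \<open>All vertices of the disk have the form \<open>Inr (b, p @ t)\<close>; dropping
    the prefix recovers \<open>t\<close>. Values elsewhere are arbitrary.\<close>
  define f :: "'v + 'v \<times> bool list \<Rightarrow> 'w + 'w \<times> bool list"
    where "f y = Inr (b', p' @ drop (length p) (snd (projr y)))" for y
  have f: "f (Inr (b, p @ t)) = Inr (b', p' @ t)" for t by (simp add: f_def)
  have pG: "pointed_graph ?G" and pH: "pointed_graph ?H"
    using B B' by (auto intro!: pointed_graph_ptr[OF pointed_graph_attach])
  note ball_iff = subtree_ball_iff[OF B(2) B'(2), of _ s p _ p']
  have vD: "y \<in> verts ?D \<longleftrightarrow> y \<in> ball_verts ?G (Suc m)" for y by (simp add: disk_graph_def)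
  have vE: "y \<in> verts ?E \<longleftrightarrow> y \<in> ball_verts ?H (Suc m)" for y by (simp add: disk_graph_def)
  have D: "\<exists>t. y = Inr (b, p @ t) \<and> Inr (b', p' @ t) \<in> verts ?E" if "y \<in> verts ?D" for y
    using that unfolding vD vE by (rule subtree_ball[OF B(2) B'(2) m]) blast
  have E: "\<exists>t. y = Inr (b', p' @ t) \<and> Inr (b, p @ t) \<in> verts ?D" if "y \<in> verts ?E" for y
    using that unfolding vD vE by (rule subtree_ball[OF B'(2) B(2) m]) blast
  have edge: "{(Inr (b, p @ t), a), (Inr (b, p @ t'), c)} \<in> edges ?D \<longleftrightarrow>
      {(Inr (b', p' @ t), a), (Inr (b', p' @ t'), c)} \<in> edges ?E" for t t' a c
    using ball_iff[of "Suc m" t] ball_iff[of "Suc m" t'] m subtree_edge_iff[OF B(2), of p t a t' c]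
      subtree_edge_iff[OF B'(2), of p' t a t' c]
    by (simp add: disk_graph_def)
  have bij: "bij_betw f (verts ?D) (verts ?E)"
  proof (rule bij_betwI')
    fix x y assume "x \<in> verts ?D" "y \<in> verts ?D"
    then show "f x = f y \<longleftrightarrow> x = y" using D[of x] D[of y] f by auto
  next
    fix x assume "x \<in> verts ?D"
    then show "f x \<in> verts ?E" using D[of x] f by auto
  next
    fix y assume "y \<in> verts ?E"
    then show "\<exists>x\<in>verts ?D. y = f x" using E[of y] f by metis
  qed
  have pD: "pointed_graph ?D" and pE: "pointed_graph ?E" by (rule pointed_graph_disk[OF pG], rule pointed_graph_disk[OF pH])
  have "pgraph_iso f ?D ?E"
  proof (rule isoI_ports[OF pD pE bij])
    fix e assume e: "e \<in> edges ?D"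
    obtain x a y c where xy: "e = {(x, a), (y, c)}" "x \<in> verts ?D" "y \<in> verts ?D" by (rule edgeE[OF pD e])
    obtain t t' where t: "x = Inr (b, p @ t)" "y = Inr (b, p @ t')" using D xy(2,3) by blast
    show "map_prod f id ` e \<in> edges ?E" using e unfolding xy(1) t by (simp add: f edge)
    show "elab ?E (map_prod f id ` e) = elab ?D e"
      unfolding xy(1) t by (simp add: f disk_graph_def restrict_map_def)
  next
    fix e u a assume e: "e \<in> edges ?E" "u \<in> verts ?D" "(f u, a) \<in> e"
    obtain y c where y: "e = {(f u, a), (y, c)}" by (rule edge_atE[OF pE e(1,3)])
    obtain t where t: "u = Inr (b, p @ t)" using D e(2) by blast
    have "y \<in> verts ?E" using edge_verts[OF pE e(1), of y c] y by simp
    then obtain t' where "y = Inr (b', p' @ t')" using E by blast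
    then have "{(Inr (b, p @ t), a), (Inr (b, p @ t'), c)} \<in> edges ?D"
      using e(1) unfolding y t edge by (simp add: f)
    then show "\<exists>e'\<in>edges ?D. (u, a) \<in> e'" using t by blast
  next
    fix v assume v: "v \<in> verts ?D"
    obtain t where t: "v = Inr (b, p @ t)" using D v by blast
    show "vlab ?E (f v) = vlab ?D v"
      using ball_iff[of m t] m B(2) B'(2) by (simp add: t f disk_graph_def restrict_map_def)
  next
    show "ptr ?E = f (ptr ?D)" by (simp add: disk_graph_def f)
  qed
  then show ?thesis using that f by blast
qed

section \<open>The given dynamics at large depth\<close>

lemma graph_R_cong:
  assumes "F X = F' X" "\<And>v. v \<in> V X \<Longrightarrow> R X v = R' X v"
  shows "dom_R F R m X = dom_R F' R' m X" "graph_R F R n m X = graph_R F' R' n m X"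
proof -
  show "dom_R F R m X = dom_R F' R' m X" using assms by (auto simp: dom_R_def)
  then show "graph_R F R n m X = graph_R F' R' n m X"
    using assms unfolding graph_R_def by (intro image_cong) (auto simp: dom_R_def)
qed

text \<open>Base vertices have no child port, so a step through such a port places the pointer
  inside a tree. Applied to the image of a configuration pointed at depth \<open>q\<close>, this
  locates the image of the pointer.\<close>

lemma attach_tree_image:
  assumes Y: "Y \<in> Y_set \<Sigma> \<Delta> \<pi>" and w: "tree_path [d] \<in> paths Y"
  obtains B :: "(nat, 's mlabel, 'd, 'p mport) pgraph" and b p
  where "base_graph \<Sigma> \<Delta> \<pi> B" "b \<in> verts B" "Y = iso_class ((attach_graph B)\<lparr>ptr := Inr (b, p)\<rparr>)"
proof -
  obtain B :: "(nat, 's mlabel, 'd, 'p mport) pgraph" and x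
    where B: "base_graph \<Sigma> \<Delta> \<pi> B" "x \<in> verts (attach_graph B)" "pointed_graph ((attach_graph B)\<lparr>ptr := x\<rparr>)"
      "Y = iso_class ((attach_graph B)\<lparr>ptr := x\<rparr>)"
    by (rule Y_setE[OF Y])
  obtain z where z: "{(x, child_port d), (z, Port_m)} \<in> edges (attach_graph B)"
    using w by (auto simp: B(4) paths_iso_class[OF B(3)])
  show ?thesis
  proof (cases x)
    case (Inl v)
    have "(Inl v, child_port d) \<in> {(x, child_port d), (z, Port_m)}" using Inl by simp
    with z have False
    proof (cases rule: attach_edge_InlE)
      case (base e0)
      then show ?thesis using base_graph_port[OF B(1) base(1,2)] by auto
    qed simp
    then show ?thesis ..
  next
    case (Inr y)
    then show ?thesis using that[of B "fst y" "snd y"] B by (cases y) simp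
  qed
qed

text \<open>Quiescence is applied to \<open>X0\<close>, pointed at the ancestor \<open>p\<close> of
  depth \<open>q\<close>, and shift invariance carries the result down to \<open>X\<close>. The
  subtree below \<open>p\<close> is thereby mapped onto the subtree below a node \<open>p'\<close>
  of the image, word by word. The node \<open>p'\<close> may differ from \<open>p\<close>, but the
  disks involved do not reach above either of them.\<close>

lemma deep_dynamics:
  fixes B :: "(nat, 's mlabel, 'd, 'p mport) pgraph"
  assumes imcgd: "IMCGD \<Sigma> \<Delta> \<pi> F R"
    and q: "\<forall>X\<in>X_base \<Sigma> \<Delta> \<pi>. \<forall>s\<in>tree_words. \<forall>t\<in>tree_words. q \<le> length s \<longrightarrow>
        R (matter_shift X s) (vtx (matter_shift X s) t) = vtx (F (matter_shift X s)) t"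
    and B: "base_graph \<Sigma> \<Delta> \<pi> B" "b \<in> verts B" and s: "q + Suc m \<le> length s"
    and X: "X = iso_class ((attach_graph B)\<lparr>ptr := Inr (b, s)\<rparr>)"
  shows "disk m (F X) = disk m X"
    "dom_R F R m X = dom_R (\<lambda>X. X) (\<lambda>X v. v) m X"
    "graph_R F R n m X = graph_R (\<lambda>X. X) (\<lambda>X v. v) n m X"
proof -
  \<comment> \<open>The cut at depth \<open>q\<close> makes \<open>p\<close> just deep enough for
    quiescence and leaves a word \<open>t\<close> of length at least \<open>Suc m\<close>, the
    margin required by \<open>subtree_disk_iso\<close>.\<close>
  define p where "p = take q s"
  define t where "t = drop q s"
  have pt: "s = p @ t" "q \<le> length p" "Suc m \<le> length t" using s by (simp_all add: p_def t_def)
  have dyn: "dynamics (Y_set \<Sigma> \<Delta> \<pi>) F R" and shift: "shift_invariant (Y_set \<Sigma> \<Delta> \<pi>) F R"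
    and pres: "vertex_preserving (Y_set \<Sigma> \<Delta> \<pi>) F R"
    using imcgd by (simp_all add: IMCGD_def CGD_def)
  let ?K = "(attach_graph B)\<lparr>ptr := Inr (b, p)\<rparr>" and ?G = "(attach_graph B)\<lparr>ptr := Inr (b, p @ t)\<rparr>"
  define X0 where "X0 = iso_class ?K"
  have G0: "pointed_graph ?K" and G: "pointed_graph ?G"
    using B by (auto intro!: pointed_graph_ptr[OF pointed_graph_attach])
  have X0: "X0 \<in> Y_set \<Sigma> \<Delta> \<pi>" and XY: "X \<in> Y_set \<Sigma> \<Delta> \<pi>"
    using B by (simp_all add: Y_setI X0_def X)
  have sh: "X0 = matter_shift (iso_class (B\<lparr>ptr := b\<rparr>)) (tree_path p)"
    by (simp add: X0_def matter_shift_eq[OF B])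
  have base: "iso_class (B\<lparr>ptr := b\<rparr>) \<in> X_base \<Sigma> \<Delta> \<pi>"
    using base_graph_ptr[OF B] by (auto simp: pgms_def base_graph_def)
  have v0: "vtx X0 (tree_path u) = paths_to ?K (Inr (b, p @ u))" for u
    unfolding X0_def by (rule vtx_iso_class[OF G0]) (simp add: walk_attach_tree[OF B(2)])
  have R0: "R X0 (paths_to ?K (Inr (b, p @ u))) = vtx (F X0) (tree_path u)" for u
  proof -
    have "R X0 (vtx X0 (tree_path u)) = vtx (F X0) (tree_path u)"
      using q base pt(2) unfolding sh tree_words_eq by simp
    then show ?thesis by (simp add: v0)
  qed
  have inV0: "paths_to ?K (Inr (b, p @ u)) \<in> V X0" for u
    using B(2) by (auto simp: X0_def V_iso_class[OF G0])
  have FX0: "F X0 \<in> Y_set \<Sigma> \<Delta> \<pi>" and RV: "v \<in> V X0 \<Longrightarrow> R X0 v \<in> V (F X0)" for v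
    using dyn X0 by (auto simp: dynamics_def)
  have FX0c: "represented (F X0)"
    using FX0 Y_set_subset_closure represented_closure by blast
  \<comment> \<open>By quiescence this set is the image under \<open>R X0\<close> of an actual
    vertex, hence a vertex of \<open>F X0\<close>, whereas a word that is not a path would designate
    the empty set. The word \<open>[False]\<close> is an arbitrary choice of child.\<close>
  have "vtx (F X0) (tree_path [False]) \<noteq> {}"
  proof -
    obtain K :: "(nat, _, _, _) pgraph" where K: "pointed_graph K" "F X0 = iso_class K"
      using FX0c by (auto simp: represented_def)
    have "R X0 (paths_to ?K (Inr (b, p @ [False]))) \<in> V (F X0)" by (rule RV[OF inV0])
    then have "vtx (F X0) (tree_path [False]) \<in> V (F X0)" unfolding R0 .
    then show ?thesis using paths_to_nonempty[OF K(1)] by (auto simp: K(2) V_iso_class[OF K(1)])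
  qed
  then have "tree_path [False] \<in> paths (F X0)" by (rule vtx_nonempty)
  from FX0 this obtain B' :: "(nat, 's mlabel, 'd, 'p mport) pgraph" and b' p'
    where B': "base_graph \<Sigma> \<Delta> \<pi> B'" "b' \<in> verts B'" and FX0': "F X0 = iso_class ((attach_graph B')\<lparr>ptr := Inr (b', p')\<rparr>)"
    by (rule attach_tree_image)
  let ?L = "(attach_graph B')\<lparr>ptr := Inr (b', p')\<rparr>" and ?H = "(attach_graph B')\<lparr>ptr := Inr (b', p' @ t)\<rparr>"
  have H0: "pointed_graph ?L" and H: "pointed_graph ?H"
    using B' by (auto intro!: pointed_graph_ptr[OF pointed_graph_attach])
  have R0': "R X0 (paths_to ?K (Inr (b, p @ u))) = paths_to ?L (Inr (b', p' @ u))" for u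
    unfolding R0 FX0' by (rule vtx_iso_class[OF H0]) (simp add: walk_attach_tree[OF B'(2)])
  let ?u = "paths_to ?K (Inr (b, p @ t))"
  have vG: "Inr (b, p @ u) \<in> verts ?K" and vH: "Inr (b', p' @ u) \<in> verts ?L" for u
    using B(2) B'(2) by simp_all
  have shX: "shift X0 ?u = X"
    using shift_iso_class[OF G0 vG] by (simp add: X0_def X pt(1))
  have FX: "F X = iso_class ?H"
  proof -
    have "F X = shift (F X0) (R X0 ?u)" using shift X0 inV0 unfolding shift_invariant_def shX[symmetric] by blast
    then show ?thesis using shift_iso_class[OF H0 vH] by (simp add: R0' FX0')
  qed
  have XG: "X = iso_class ?G" by (simp add: X pt(1))
  \<comment> \<open>Shift invariance only determines the concatenation of \<open>R X0 ?u\<close>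
    with the wanted value. Seen from the pointer of \<open>F X0\<close>, distinct vertices have
    distinct path sets, so the first factor can be cancelled.\<close>
  have R: "R X (paths_to ?G (Inr (b, p @ u))) = paths_to ?H (Inr (b', p' @ u))" for u
  proof -
    let ?v = "paths_to ?G (Inr (b, p @ u))"
    have v: "?v \<in> V X" using B(2) by (auto simp: XG V_iso_class[OF G])
    then have "R X ?v \<in> V (F X)" using dyn XY by (auto simp: dynamics_def)
    then obtain y where y: "y \<in> verts ?H" "R X ?v = paths_to ?H y" by (auto simp: FX V_iso_class[OF H])
    have "conc X0 ?u ?v = paths_to ?K (Inr (b, p @ u))"
      unfolding X0_def
      by (rule conc_iso_class[OF G0 vG]) (use paths_to_nonempty[OF G] vG in auto)
    moreover have "R X0 (conc X0 ?u ?v) = conc (F X0) (R X0 ?u) (R X ?v)"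
      using shift X0 inV0[of t] v unfolding shift_invariant_def shX[symmetric] by blast
    moreover have "conc (F X0) (R X0 ?u) (paths_to ?H y) = paths_to ?L y"
      unfolding FX0' R0'
      by (rule conc_iso_class[OF H0 vH]) (use paths_to_nonempty[OF H y(1)] in auto)
    ultimately have "paths_to ?L (Inr (b', p' @ u)) = paths_to ?L y" by (simp add: R0' y(2))
    then have "y = Inr (b', p' @ u)" using paths_to_inj[OF H0 vH] y(1) by simp
    then show ?thesis using y(2) by simp
  qed
  obtain f where f: "pgraph_iso f (disk_graph m ?G) (disk_graph m ?H)"
    "\<And>u. f (Inr (b, p @ u)) = Inr (b', p' @ u)"
    by (rule subtree_disk_iso[OF B B' pt(3), where p = p and p' = p']) blast
  note pG = pointed_graph_disk[OF G, of m]
  show d: "disk m (F X) = disk m X"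
    unfolding FX unfolding XG disk_iso_class[OF G] disk_iso_class[OF H]
    by (rule iso_class_eqI[OF f(1) pG, symmetric])
  have ball: "\<exists>u. x = Inr (b, p @ u) \<and> Inr (b', p' @ u) \<in> ball_verts ?H (Suc m)"
    if "x \<in> ball_verts ?G (Suc m)" for x
    using that by (rule subtree_ball[OF B(2) B'(2) pt(3)]) blast
  have ball': "\<exists>u. x = Inr (b', p' @ u) \<and> Inr (b, p @ u) \<in> ball_verts ?G (Suc m)"
    if "x \<in> ball_verts ?H (Suc m)" for x
    using that by (rule subtree_ball[OF B'(2) B(2) pt(3)]) blast
  have dom_id: "dom_R (\<lambda>X. X) (\<lambda>X v. v) m X = paths_to ?G ` ball_verts ?G (Suc m)"
    using ball_verts_subset[OF G, of "Suc m"] in_disk_iff[OF G]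
    by (auto simp: dom_R_def XG V_iso_class[OF G])
  show dom: "dom_R F R m X = dom_R (\<lambda>X. X) (\<lambda>X v. v) m X"
  proof (intro equalityI subsetI)
    fix v assume "v \<in> dom_R F R m X"
    then have v: "v \<in> V X" "in_disk m (F X) (R X v)" by (simp_all add: dom_R_def)
    then have "R X v \<in> V (F X)" using dyn XY by (auto simp: dynamics_def)
    then obtain y where y: "y \<in> verts ?H" "R X v = paths_to ?H y" by (auto simp: FX V_iso_class[OF H])
    then have "y \<in> ball_verts ?H (Suc m)" using v(2) in_disk_iff[OF H y(1)] by (simp add: FX)
    then obtain u where u: "y = Inr (b', p' @ u)" "Inr (b, p @ u) \<in> ball_verts ?G (Suc m)" using ball' by blast
    \<comment> \<open>The vertex \<open>Inr (b, p @ u)\<close> is already sent to \<open>y\<close>;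
      injectivity excludes any other preimage, in particular one outside the subtree.\<close>
    have "inj_on (R X) (V X)" using pres XY by (simp add: vertex_preserving_def bij_betw_def)
    moreover have "paths_to ?G (Inr (b, p @ u)) \<in> V X" using B(2) by (auto simp: XG V_iso_class[OF G])
    moreover have "R X v = R X (paths_to ?G (Inr (b, p @ u)))" by (simp add: R y(2) u(1))
    ultimately have "v = paths_to ?G (Inr (b, p @ u))" using v(1) by (simp add: inj_on_def)
    then show "v \<in> dom_R (\<lambda>X. X) (\<lambda>X v. v) m X" using u(2) dom_id by simp
  next
    fix v assume "v \<in> dom_R (\<lambda>X. X) (\<lambda>X v. v) m X"
    then obtain x where x: "x \<in> ball_verts ?G (Suc m)" "v = paths_to ?G x" using dom_id by blast
    then obtain u where u: "x = Inr (b, p @ u)" "Inr (b', p' @ u) \<in> ball_verts ?H (Suc m)" using ball by blast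
    have "in_disk m (F X) (R X v)"
      using in_disk_iff[OF H, of "Inr (b', p' @ u)"] u B'(2) by (simp add: x(2) R FX)
    then show "v \<in> dom_R F R m X" using x u(1) B(2) by (auto simp: dom_R_def XG V_iso_class[OF G])
  qed
  have "R X v \<inter> paths (disk m (F X)) = v \<inter> paths (disk m X)" if v: "v \<in> dom_R F R m X" for v
  proof -
    obtain x where x: "x \<in> ball_verts ?G (Suc m)" "v = paths_to ?G x" using v dom dom_id by blast
    then obtain u where u: "x = Inr (b, p @ u)" "Inr (b', p' @ u) \<in> ball_verts ?H (Suc m)" using ball by blast
    have xD: "x \<in> verts (disk_graph m ?G)" using x(1) by (simp add: disk_graph_def)
    have "R X v \<inter> paths (disk m (F X)) = paths_to (disk_graph m ?H) (f x)"
      using paths_to_disk[OF H, of "Inr (b', p' @ u)" m] u by (simp add: x(2) R FX f(2))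
    \<comment> \<open>An isomorphism that respects the pointer leaves the words leading to a vertex
      unchanged, so corresponding vertices are literally the same set of paths.\<close>
    also have "\<dots> = paths_to (disk_graph m ?G) x"
      unfolding paths_to_def using iso_walk_ptr[OF f(1) pG xD] by blast
    also have "\<dots> = v \<inter> paths (disk m X)" using paths_to_disk[OF G, of x m] x by (simp add: XG)
    finally show ?thesis .
  qed
  then show "graph_R F R n m X = graph_R (\<lambda>X. X) (\<lambda>X v. v) n m X"
    unfolding graph_R_def dom[symmetric] by (intro image_cong) auto
qed

section \<open>The extension\<close>

theorem theorem11:
  fixes \<Sigma> :: "'s set" and \<Delta> :: "'d set" and \<pi> :: "'p set"
    and F :: "('s mlabel, 'd, 'p mport) gmap"
    and R :: "('s mlabel, 'd, 'p mport) vmap"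
  assumes "finite \<Sigma>" and "finite \<Delta>" and "finite \<pi>"
    and "IMCGD \<Sigma> \<Delta> \<pi> F R"
  shows "\<exists>F' R'. extension_to_closure \<Sigma> \<Delta> \<pi> F R F' R' \<and>
           CGD (Y_closure \<Sigma> \<Delta> \<pi>) F' R' \<and>
           vertex_preserving (Y_closure \<Sigma> \<Delta> \<pi>) F' R' \<and>
           invisible_matter_quiescent \<Sigma> \<Delta> \<pi> F' R'"
proof -
  let ?Y = "Y_set \<Sigma> \<Delta> \<pi>" and ?C = "Y_closure \<Sigma> \<Delta> \<pi>"
  define F' where "F' X = (if X \<in> ?Y then F X else X)" for X
  define R' where "R' X v = (if X \<in> ?Y then R X v else v)" for X v
  have old: "F' X = F X" "R' X = R X" if "X \<in> ?Y" for X
    using that by (simp_all add: F'_def R'_def fun_eq_iff)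
  have new: "F' X = X" "R' X = (\<lambda>v. v)" if "X \<notin> ?Y" for X
    using that by (simp_all add: F'_def R'_def fun_eq_iff)
  have dyn: "dynamics ?Y F R" and cont: "continuous_dyn ?Y F R"
    and shift: "shift_invariant ?Y F R" and bound: "bounded_dyn ?Y F R"
    and pres: "vertex_preserving ?Y F R" and imq: "invisible_matter_quiescent \<Sigma> \<Delta> \<pi> F R"
    using assms(4) by (simp_all add: IMCGD_def CGD_def)
  note sub = Y_set_subset_closure[of \<Sigma> \<Delta> \<pi>]

  have dyn': "dynamics ?C F' R'"
    unfolding dynamics_def
  proof
    fix X assume "X \<in> ?C"
    then show "F' X \<in> ?C \<and> (\<forall>v\<in>V X. R' X v \<in> V (F' X))"
      using dyn sub by (cases "X \<in> ?Y") (auto simp: old new dynamics_def)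
  qed

  have pres': "vertex_preserving ?C F' R'"
    unfolding vertex_preserving_def
  proof
    fix X assume "X \<in> ?C"
    then show "bij_betw (R' X) (V X) (V (F' X))"
      using pres by (cases "X \<in> ?Y") (auto simp: old new vertex_preserving_def bij_betw_def)
  qed

  have imq': "invisible_matter_quiescent \<Sigma> \<Delta> \<pi> F' R'"
  proof -
    \<comment> \<open>Quiescence evaluates the dynamics at such points only, and there the extension
      agrees with the given dynamics.\<close>
    have "matter_shift X s \<in> ?Y" if X: "X \<in> X_base \<Sigma> \<Delta> \<pi>" and s: "s \<in> tree_words" for X s
    proof -
      obtain B :: "(nat, _, _, _) pgraph" where B: "base_graph \<Sigma> \<Delta> \<pi> B" "X = iso_class B"
        using X by (auto simp: pgms_def base_graph_def)
      have ptr: "ptr B \<in> verts B" using B(1) by (simp add: base_graph_def ptr_in_verts)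
      obtain u where "s = tree_path u" using s by (auto simp: tree_words_eq)
      then have "matter_shift X s = iso_class ((attach_graph B)\<lparr>ptr := Inr (ptr B, u)\<rparr>)"
        using matter_shift_eq[OF B(1) ptr, of u] B(2) by simp
      then show ?thesis using B(1) ptr by (simp add: Y_setI)
    qed
    then show ?thesis using imq by (simp add: invisible_matter_quiescent_def old)
  qed

  have shift': "shift_invariant ?C F' R'"
    unfolding shift_invariant_def
  proof (intro ballI)
    fix X u assume X: "X \<in> ?C" and u: "u \<in> V X"
    have "shift X u \<in> ?Y \<longleftrightarrow> X \<in> ?Y" by (rule Y_set_shift_iff[OF represented_closure[OF X] u])
    then show "F' (shift X u) = shift (F' X) (R' X u) \<and>
      (\<forall>v\<in>V (shift X u). R' X (conc X u v) = conc (F' X) (R' X u) (R' (shift X u) v))"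
      using shift u by (cases "X \<in> ?Y") (simp_all add: old new shift_invariant_def)
  qed

  have bound': "bounded_dyn ?C F' R'"
  proof -
    obtain k where k: "\<forall>X\<in>?Y. \<forall>w'\<in>V (F X). \<exists>u'\<in>R X ` V X. \<exists>v'\<in>V (disk k (Defs.shift (F X) u')). w' = conc (F X) u' v'"
      using bound unfolding bounded_dyn_def by blast
    have "\<exists>u'\<in>R' X ` V X. \<exists>v'\<in>V (disk k (Defs.shift (F' X) u')). w' = conc (F' X) u' v'"
      if X: "X \<in> ?C" and w: "w' \<in> V (F' X)" for X w'
    proof (cases "X \<in> ?Y")
      case True
      then show ?thesis using k w by (simp add: old)
    next
      case False
      obtain G :: "(nat, _, _, _) pgraph" where G: "pointed_graph G" "X = iso_class G"
        using X by (rule Y_closureE)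
      obtain v where v: "v \<in> verts G" "w' = paths_to G v" using w False G by (auto simp: new V_iso_class)
      let ?H = "G\<lparr>ptr := v\<rparr>"
      have H: "pointed_graph ?H" by (rule pointed_graph_ptr[OF G(1) v(1)])
      note D = pointed_graph_disk[OF H, of k]
      \<comment> \<open>For the identity every vertex is its own image, so the displacement is zero:
        the second factor is the pointer of the disk, whatever its radius \<open>k\<close>.\<close>
      let ?v = "paths_to (disk_graph k ?H) (ptr (disk_graph k ?H))"
      have D': "disk k (Defs.shift X w') = iso_class (disk_graph k ?H)"
        using shift_iso_class[OF G(1) v(1)] disk_iso_class[OF H] by (simp add: G(2) v(2))
      have p: "ptr (disk_graph k ?H) = v" by (simp add: disk_graph_def)
      have "?v \<in> V (disk k (Defs.shift X w'))" unfolding D' V_iso_class[OF D] using ptr_in_verts[OF D] by blast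
      moreover have "conc X w' ?v = w'"
        unfolding G(2) v(2)
      proof (rule conc_iso_class[OF G(1) v(1)])
        show "?v \<noteq> {}" by (rule paths_to_nonempty[OF D ptr_in_verts[OF D]])
        show "?v \<subseteq> paths_to ?H v" using disk_walk_imp[OF H] by (auto simp: paths_to_def p)
      qed
      ultimately show ?thesis using w by (auto simp: new[OF False])
    qed
    then show ?thesis unfolding bounded_dyn_def by blast
  qed

  have cont': "continuous_dyn ?C F' R'"
    unfolding continuous_dyn_def
  proof (intro ballI allI)
    fix X m assume X: "X \<in> ?C"
    let ?P = "\<lambda>n X'. disk m (F' X) = disk m (F' X') \<and>
        (\<forall>v\<in>dom_R F' R' m X. in_disk n X v) \<and> (\<forall>v\<in>dom_R F' R' m X'. in_disk n X' v) \<and>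
        graph_R F' R' n m X = graph_R F' R' n m X'"
    note rep = represented_closure
    have cong: "dom_R F' R' j Z = dom_R F R j Z" "graph_R F' R' n j Z = graph_R F R n j Z" if "Z \<in> ?Y" for Z j n
      using graph_R_cong[of F' Z F R' R] old[OF that] by simp_all
    have cong': "dom_R F' R' j Z = dom_R (\<lambda>X. X) (\<lambda>X v. v) j Z"
      "graph_R F' R' n j Z = graph_R (\<lambda>X. X) (\<lambda>X v. v) n j Z" if "Z \<notin> ?Y" for Z j n
      using graph_R_cong[of F' Z "\<lambda>X. X" R' "\<lambda>X v. v"] new[OF that] by simp_all
    obtain G :: "(nat, _, _, _) pgraph" where G: "matter_graph \<Sigma> \<Delta> \<pi> G" "pointed_graph G" "X = iso_class G"
      using X by (rule Y_closureE)
    have disk_mono: "disk j X' = disk j X"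
      if X': "X' \<in> ?C" and eq: "disk n X' = disk n X" and j: "j \<le> n" for X' j n
    proof -
      obtain H :: "(nat, _, _, _) pgraph" where H: "pointed_graph H" "X' = iso_class H"
        using X' by (rule Y_closureE)
      show ?thesis using disk_eq_mono[OF H(1) G(2) j] eq by (simp add: H(2) G(3))
    qed
    show "\<exists>n. \<forall>X'\<in>?C. disk n X' = disk n X \<longrightarrow> ?P n X'"
    proof (cases "X \<in> ?Y")
      case True
      obtain B :: "(nat, _, _, _) pgraph" and x
        where B: "base_graph \<Sigma> \<Delta> \<pi> B" "x \<in> verts (attach_graph B)" "pointed_graph ((attach_graph B)\<lparr>ptr := x\<rparr>)"
          "X = iso_class ((attach_graph B)\<lparr>ptr := x\<rparr>)"
        by (rule Y_setE[OF True])
      let ?A = "(attach_graph B)\<lparr>ptr := x\<rparr>"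
      have "ptr B \<in> verts B" using B(1) by (simp add: base_graph_def ptr_in_verts)
      then have "Inl (ptr B) \<in> verts ?A" by simp
      \<comment> \<open>Within radius \<open>d\<close> the disk of \<open>X\<close> shows a vertex
        not labelled \<open>m\<close>, so every point with the same disk has one too.\<close>
      from in_some_ball[OF B(3) this] obtain d where d: "Inl (ptr B) \<in> ball_verts ?A d" .
      have nm: "\<not> is_matter ?A (Inl (ptr B))" using base_graph_label[OF B(1)] by (simp add: is_matter_def)
      obtain k where k: "\<forall>X'\<in>?Y. disk k X' = disk k X \<longrightarrow>
          disk m (F X) = disk m (F X') \<and>
          (\<forall>v\<in>dom_R F R m X. in_disk k X v) \<and> (\<forall>v\<in>dom_R F R m X'. in_disk k X' v) \<and>
          graph_R F R k m X = graph_R F R k m X'"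
        using cont True unfolding continuous_dyn_def by blast
      \<comment> \<open>\<open>d\<close> forces \<open>X'\<close> into \<open>Y_set\<close>;
        \<open>k\<close> is the radius of continuity of the given dynamics.\<close>
      have "?P (max k d) X'" if X': "X' \<in> ?C" and eq: "disk (max k d) X' = disk (max k d) X" for X'
      proof -
        obtain H :: "(nat, _, _, _) pgraph"
          where H: "matter_graph \<Sigma> \<Delta> \<pi> H" "pointed_graph H" "X' = iso_class H"
          using X' by (rule Y_closureE)
        have "\<exists>c\<in>ball_verts H d. \<not> is_matter H c"
        proof (rule ccontr)
          assume "\<not> ?thesis"
          then have "is_matter ?A (Inl (ptr B))"
            using disk_eq_matter[OF H(2) B(3) _ _ d] disk_mono[OF X' eq, of d] by (simp add: H(3) B(4))
          then show False using nm by blast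
        qed
        then have Y': "X' \<in> ?Y"
          using Y_set_if_base_vertex[OF H(1)] ball_verts_subset[OF H(2)] H(3) by blast
        have eqk: "disk k X' = disk k X" by (rule disk_mono[OF X' eq]) simp
        note kX = k[rule_format, OF Y' eqk]
        have V: "v \<in> V Z" if "v \<in> dom_R F R m Z" for v Z using that by (simp add: dom_R_def)
        \<comment> \<open>Continuity gives the equality at radius \<open>k\<close>;
          \<open>graph_R_mono\<close> lifts both sides by the same function, as the larger disks
          coincide.\<close>
        have "graph_R F R (max k d) m X = graph_R F R (max k d) m X'"
          using graph_R_mono[OF rep[OF X], of F R m k "max k d"] graph_R_mono[OF rep[OF X'], of F R m k "max k d"] kX eq by simp
        moreover have "\<forall>v\<in>dom_R F R m X. in_disk (max k d) X v"
          using kX in_disk_mono[OF rep[OF X] V, of _ k "max k d"] by auto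
        moreover have "\<forall>v\<in>dom_R F R m X'. in_disk (max k d) X' v"
          using kX in_disk_mono[OF rep[OF X'] V, of _ k "max k d"] by auto
        ultimately show ?thesis using kX by (simp add: old[OF True] old[OF Y'] cong[OF True] cong[OF Y'])
      qed
      then show ?thesis by blast
    next
      case False
      have all: "\<forall>v\<in>verts G. is_matter G v" using Y_set_if_base_vertex[OF G(1)] False G(3) by blast
      obtain q where q: "\<forall>X\<in>X_base \<Sigma> \<Delta> \<pi>. \<forall>s\<in>tree_words. \<forall>t\<in>tree_words. q \<le> length s \<longrightarrow>
          R (matter_shift X s) (vtx (matter_shift X s) t) = vtx (F (matter_shift X s)) t"
        using imq unfolding invisible_matter_quiescent_def by blast
      \<comment> \<open>The least depth accepted by \<open>deep_dynamics\<close>.\<close>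
      define n where "n = q + Suc m"
      have mn: "m \<le> n" by (simp add: n_def)
      \<comment> \<open>Near \<open>X\<close> the extension looks like the identity at radius
        \<open>m\<close>, at old and new points alike. Applied to \<open>X'\<close> and to
        \<open>X\<close>, this reduces continuity to that of the identity.\<close>
      have id: "disk m (F' X') = disk m X' \<and> dom_R F' R' m X' = dom_R (\<lambda>X. X) (\<lambda>X v. v) m X' \<and>
          graph_R F' R' n m X' = graph_R (\<lambda>X. X) (\<lambda>X v. v) n m X'"
        if X': "X' \<in> ?C" and eq: "disk n X' = disk n X" for X'
      proof (cases "X' \<in> ?Y")
        case True
        obtain B :: "(nat, _, _, _) pgraph" and x
          where B: "base_graph \<Sigma> \<Delta> \<pi> B" "x \<in> verts (attach_graph B)" "pointed_graph ((attach_graph B)\<lparr>ptr := x\<rparr>)"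
            "X' = iso_class ((attach_graph B)\<lparr>ptr := x\<rparr>)"
          by (rule Y_setE[OF True])
        let ?A = "(attach_graph B)\<lparr>ptr := x\<rparr>"
        \<comment> \<open>\<open>X\<close> consists of matter only and shares its disk of radius
          \<open>n\<close> with \<open>X'\<close>, so no base vertex of \<open>X'\<close> is within
          distance \<open>n\<close>.\<close>
        have deep: "Inl v \<notin> ball_verts ?A n" for v
        proof
          assume v: "Inl v \<in> ball_verts ?A n"
          have "is_matter ?A (Inl v)"
            using disk_eq_matter[OF G(2) B(3) _ _ v] eq all ball_verts_subset[OF G(2), of n]
            by (auto simp: G(3) B(4))
          then show False using base_graph_label[OF B(1)] by (simp add: is_matter_def)
        qed
        obtain b s where x: "x = Inr (b, s)"
        proof (cases x)
          case (Inl v)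
          then show ?thesis using deep[of v] ptr_in_ball[OF B(3), of n] by simp
        next
          case (Inr y)
          then show ?thesis using that by (cases y) simp
        qed
        have b: "b \<in> verts B" using B(2) x by simp
        have A: "pointed_graph (attach_graph B)" by (rule pointed_graph_attach[OF B(1)])
        have "walk (attach_graph B) (map prod.swap (rev ((Port_m, Port_m) # tree_path s))) (Inr (b, s)) (Inl b)"
          using walk_rev[OF _ walk_attach_root[OF b, of s]] A by (simp add: pointed_graph_def)
        \<comment> \<open>Climbing to the root takes \<open>length s\<close> steps and one more
          reaches the base vertex \<open>b\<close>. As \<open>b\<close> is farther than
          \<open>n\<close>, the depth \<open>length s\<close> is at least \<open>n\<close>.\<close>
        then have "Inl b \<in> ball_verts ?A (Suc (length s))"
          unfolding ball_verts_def x by force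
        then have "\<not> Suc (length s) \<le> n"
          using deep[of b] ball_mono[of "Suc (length s)" n ?A] by blast
        then have "q + Suc m \<le> length s" by (simp add: n_def)
        then show ?thesis
          using deep_dynamics[OF assms(4) q B(1) b _ B(4)[unfolded x], of m]
          by (simp add: old[OF True] cong[OF True])
      next
        case False
        then show ?thesis by (simp add: new cong')
      qed
      have "?P n X'" if X': "X' \<in> ?C" and eq: "disk n X' = disk n X" for X'
      proof -
        have eqm: "disk m X' = disk m X" by (rule disk_mono[OF X' eq mn])
        have dom: "in_disk n Z v" if "Z \<in> ?C" "v \<in> dom_R (\<lambda>X. X) (\<lambda>X v. v) m Z" for Z v
          using that(2) in_disk_mono[OF rep[OF that(1)] _ _ mn] by (simp add: dom_R_def)
        show ?thesis
          using id[OF X' eq] id[OF X refl] eqm eq dom X X'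
            graph_R_identity[OF rep[OF X] mn] graph_R_identity[OF rep[OF X'] mn] by simp
      qed
      then show ?thesis by blast
    qed
  qed

  have "extension_to_closure \<Sigma> \<Delta> \<pi> F R F' R'"
    using dyn' by (simp add: extension_to_closure_def old)
  then show ?thesis using dyn' cont' shift' bound' pres' imq' unfolding CGD_def by blast
qed

end
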